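(* Let $\Omega$ be a set, and let $G \le \mathrm{Sym}(\Omega)$ be such that $\pi(G)$ is a chain. There is a prime $p$ such that the length of any cycle of any element of $G$ is a power of $p$. Furthermore, $G$ is abelian, and either periodic or torsion-free. (a) If $G$ is periodic then $G$ is either a finite cyclic group of $p$-power order, or else isomorphic to the Prüfer $p$-group. (b) If $G$ is torsion-free then $G$ is isomorphic to a subgroup of the $p$-adic rational numbers $\mathbf{Q}_p$. In this case $G$ has infinitely many orbits on $\Omega$, and the permutation group induced by its action on any single orbit is periodic.
   Context: For a permutation $g$ of $\Omega$, $\pi(g)$ denotes the partition of $\Omega$ into the orbits of $g$ (that is, of $\langle g\rangle$), and $\pi(G)=\{\pi(g)\mid g\in G\}$. Partitions of $\Omega$ are ordered by refinement: $\mathcal{P}\preccurlyeq\mathcal{Q}$ if every part of $\mathcal{P}$ is contained in a part of $\mathcal{Q}$. To say $\pi(G)$ is a chain means that it is totally ordered by $\preccurlyeq$. A group is periodic if all its elements have finite order, and torsion-free if no non-identity element has finite order. The Prüfer $p$-group is the subgroup of $\mathbf{Q}/\mathbf{Z}$ generated by the cosets containing $1/p^i$ for $i\in\mathbf{N}$. $\mathbf{Q}_p$ is regarded as a group under addition.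
   Formalization: In (b), "G has infinitely many orbits on Ω" is stated only for non-trivial G: the trivial group is torsion-free (and periodic) by the definitions, yet has finitely many orbits when Ω is finite, e.g. a single point. *)

theory Defs
  imports Complex_Main "HOL-Algebra.Elementary_Groups" "HOL-Algebra.Group_Action" "HOL-Algebra.QuotRing"
    "HOL-Computational_Algebra.Primes" "HOL-Library.Disjoint_Sets"
begin

definition perm_group :: "'a set \<Rightarrow> ('a \<Rightarrow> 'a) set \<Rightarrow> ('a \<Rightarrow> 'a) monoid" where
  "perm_group \<Omega> G = (BijGroup \<Omega>)\<lparr>carrier := G\<rparr>"

text \<open>Orbits are taken under the group generated by \<open>g\<close>, so that cycles may be two-sided infinite;
  the parts of \<open>orbit_partition \<Omega> g\<close> are the (supports of the) cycles of \<open>g\<close>, fixed points included.\<close>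

definition orbit_partition :: "'a set \<Rightarrow> ('a \<Rightarrow> 'a) \<Rightarrow> 'a set set" where
  "orbit_partition \<Omega> g = orbits (subgroup_generated (BijGroup \<Omega>) {g}) \<Omega> (\<lambda>h. h)"

definition orbit_partitions :: "'a set \<Rightarrow> ('a \<Rightarrow> 'a) set \<Rightarrow> 'a set set set" where
  "orbit_partitions \<Omega> G = orbit_partition \<Omega> ` G"

definition refinement_chain :: "'a set \<Rightarrow> 'a set set set \<Rightarrow> bool" where
  "refinement_chain \<Omega> \<P> \<longleftrightarrow> (\<forall>P\<in>\<P>. \<forall>Q\<in>\<P>. refines \<Omega> P Q \<or> refines \<Omega> Q P)"

definition group_orbits :: "'a set \<Rightarrow> ('a \<Rightarrow> 'a) set \<Rightarrow> 'a set set" where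
  "group_orbits \<Omega> G = orbits (perm_group \<Omega> G) \<Omega> (\<lambda>h. h)"

definition induced_perm_group :: "('a \<Rightarrow> 'a) set \<Rightarrow> 'a set \<Rightarrow> ('a \<Rightarrow> 'a) monoid" where
  "induced_perm_group G Y = perm_group Y ((\<lambda>g. restrict g Y) ` G)"

definition finite_order :: "('a, 'b) monoid_scheme \<Rightarrow> 'a \<Rightarrow> bool" where
  "finite_order G x \<longleftrightarrow> (\<exists>n::nat. n > 0 \<and> x [^]\<^bsub>G\<^esub> n = \<one>\<^bsub>G\<^esub>)"

definition periodic :: "('a, 'b) monoid_scheme \<Rightarrow> bool" where
  "periodic G \<longleftrightarrow> (\<forall>x\<in>carrier G. finite_order G x)"

definition torsion_free :: "('a, 'b) monoid_scheme \<Rightarrow> bool" where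
  "torsion_free G \<longleftrightarrow> (\<forall>x\<in>carrier G. x \<noteq> \<one>\<^bsub>G\<^esub> \<longrightarrow> \<not> finite_order G x)"

definition rat_group :: "rat monoid" where
  "rat_group = \<lparr>carrier = UNIV, monoid.mult = (+), monoid.one = 0\<rparr>"

definition pruefer_group :: "nat \<Rightarrow> rat set monoid" where
  "pruefer_group p = subgroup_generated (rat_group Mod \<int>)
     (range (\<lambda>i::nat. \<int> #>\<^bsub>rat_group\<^esub> (1 / of_nat p ^ i)))"

text \<open>The \<open>p\<close>-adic absolute value \<open>p\<^sup>-\<^sup>v\<close> on the rationals, where \<open>v\<close> is the multiplicity
  of \<open>p\<close> in the numerator minus that in the denominator.\<close>

definition padic_abs :: "nat \<Rightarrow> rat \<Rightarrow> real" where
  "padic_abs p x = (if x = 0 then 0 else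
     (case quotient_of x of (a, b) \<Rightarrow>
        real p powi (int (multiplicity (int p) b) - int (multiplicity (int p) a))))"

definition padic_Cauchy :: "nat \<Rightarrow> (nat \<Rightarrow> rat) \<Rightarrow> bool" where
  "padic_Cauchy p s \<longleftrightarrow> (\<forall>e>0. \<exists>N. \<forall>m\<ge>N. \<forall>n\<ge>N. padic_abs p (s m - s n) < e)"

definition padic_Cauchy_ring :: "nat \<Rightarrow> (nat \<Rightarrow> rat) ring" where
  "padic_Cauchy_ring p =
     \<lparr>carrier = {s. padic_Cauchy p s},
      monoid.mult = (\<lambda>s t n. s n * t n), monoid.one = (\<lambda>_. 1),
      ring.zero = (\<lambda>_. 0), ring.add = (\<lambda>s t n. s n + t n)\<rparr>"

definition padic_null :: "nat \<Rightarrow> (nat \<Rightarrow> rat) set" where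
  "padic_null p = {s. (\<lambda>n. padic_abs p (s n)) \<longlonglongrightarrow> 0}"

text \<open>\<open>\<rat>\<^sub>p\<close> as the completion of \<open>\<rat>\<close> with respect to the \<open>p\<close>-adic absolute value.\<close>

definition padic_field :: "nat \<Rightarrow> (nat \<Rightarrow> rat) set ring" where
  "padic_field p = padic_Cauchy_ring p Quot padic_null p"

end

theory Submission
  imports Defs "HOL-Algebra.Multiplicative_Group"
begin

text \<open>Comparing \<open>\<pi>(g\<^sup>q)\<close> with \<open>\<pi>(g\<^sup>r)\<close> for distinct primes \<open>q\<close>, \<open>r\<close> shows that all cycles of \<open>g\<close> are finite
  and that their lengths are powers of one prime. If \<open>\<pi>(f)\<close> refines \<open>\<pi>(h)\<close>, the fixed points of \<open>f\<close> are
  \<open>h\<close>-invariant; applied to \<open>f = h\<^sup>-\<^sup>j g\<close> this shows that if \<open>\<pi>(g)\<close> refines \<open>\<pi>(h)\<close> then \<open>g\<close> acts on each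
  cycle of \<open>h\<close> as a power \<open>h\<^sup>j\<close>, so \<open>G\<close> is abelian. The exponents \<open>j\<close> on different cycles of \<open>h\<close> are
  compatible, because fixed point sets form a chain: an exponent on a long cycle also works on all
  shorter ones. If \<open>h\<close> has finite order, a longest cycle yields \<open>g = h\<^sup>j\<close>, so the cyclic subgroups of a
  periodic \<open>G\<close> form a chain; otherwise the exponents define a \<open>p\<close>-adic number.\<close>

section \<open>Faithful actions whose orbit partitions form a chain\<close>

text \<open>The chain condition only gives, at each point \<open>x\<close> separately, some
  \<open>i\<close> with \<open>\<phi> g x = \<phi> (h [^] i) x\<close>. Different points are linked
  because \<open>g\<close> agrees with \<open>h [^] j\<close> at \<open>y\<close> exactly when the
  single element \<open>h [^] (- j) \<otimes> g\<close> fixes \<open>y\<close>; this element lies in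
  \<open>G\<close> again, and refinement reverses inclusion of fixed-point sets. Finiteness of
  cycles has to come before this: a fixed-point set is compared with a translate of itself, and
  inclusion becomes equality only between finite sets. An infinite cycle is given length 0, which
  every prime divides, so the argument against two primes also excludes infinite cycles. In a
  torsion-free group an element \<open>h\<close> need not refine the chosen \<open>g\<close>, but
  some \<open>h [^] (p ^ n)\<close> fixes a point moved by \<open>g\<close> and therefore does. The
  claims about orbits rest on commutativity: the cycle lengths of \<open>g\<close> are constant on
  each orbit of \<open>G\<close>, so \<open>g\<close> has finite order on a single orbit, and
  finitely many orbits would give it finite order altogether.\<close>

lemma int_subgroup_multiples:
  fixes S :: "int set"
  assumes "0 \<in> S" "\<And>i j. \<lbrakk>i \<in> S; j \<in> S\<rbrakk> \<Longrightarrow> i - j \<in> S"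
  shows "\<exists>n. \<forall>i. i \<in> S \<longleftrightarrow> int n dvd i"
proof -
  have neg: "- i \<in> S" if "i \<in> S" for i
    using assms(2)[OF assms(1) that] by simp
  have add: "i + j \<in> S" if "i \<in> S" "j \<in> S" for i j
    using assms(2)[OF that(1) neg[OF that(2)]] by simp
  have mult: "int k * i \<in> S" if "i \<in> S" for k i
  proof (induction k)
    case (Suc k)
    then show ?case using add[OF that Suc] by (simp add: algebra_simps)
  qed (use assms in simp)
  have mult': "k * i \<in> S" if "i \<in> S" for k i
  proof (cases "k \<ge> 0")
    case True
    then show ?thesis using mult[OF that, of "nat k"] by simp
  next
    case False
    then show ?thesis using neg[OF mult[OF that, of "nat (- k)"]] by simp
  qed
  show ?thesis
  proof (cases "\<exists>n>0. int n \<in> S")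
    case False
    have "i = 0" if "i \<in> S" for i
    proof (rule ccontr)
      assume "i \<noteq> 0"
      then have "int (nat \<bar>i\<bar>) \<in> S" "nat \<bar>i\<bar> > 0" using that neg[OF that] by (auto simp: abs_if)
      then show False using False by blast
    qed
    then show ?thesis using assms(1) by (intro exI[of _ 0]) auto
  next
    case True
    define n where "n = (LEAST n. n > 0 \<and> int n \<in> S)"
    have n: "n > 0" "int n \<in> S" using LeastI_ex[OF True] unfolding n_def by auto
    have d: "int n dvd i" if "i \<in> S" for i
    proof -
      have nn: "int (nat (i mod int n)) = i mod int n" using n(1) by simp
      have "i mod int n \<in> S"
        using assms(2)[OF that mult'[OF n(2), of "i div int n"]] by (simp only: minus_div_mult_eq_mod)
      then have "int (nat (i mod int n)) \<in> S" by (simp only: nn)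
      moreover have "nat (i mod int n) < n" using n(1) by (simp add: nat_less_iff)
      ultimately have "nat (i mod int n) = 0"
        using not_less_Least[of "nat (i mod int n)" "\<lambda>n. n > 0 \<and> int n \<in> S"] unfolding n_def by auto
      then have "i mod int n = 0" using nn by simp
      then show ?thesis by auto
    qed
    have "i \<in> S" if "int n dvd i" for i
      using that mult'[OF n(2)] by (auto simp: dvd_def mult.commute)
    then show ?thesis using d by blast
  qed
qed

lemma prime_power_if_unique_prime:
  fixes n p :: nat
  assumes "n > 0" "\<And>q. \<lbrakk>Factorial_Ring.prime q; q dvd n\<rbrakk> \<Longrightarrow> q = p"
  shows "\<exists>k. n = p ^ k"
  using assms
proof (induction n rule: less_induct)
  case (less n)
  show ?case
  proof (cases "n = 1")
    case True
    then show ?thesis by (intro exI[of _ 0]) simp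
  next
    case False
    then obtain q where q: "Factorial_Ring.prime q" "q dvd n" using prime_factor_nat by blast
    then have qp: "q = p" using less by blast
    obtain m where m: "n = p * m" using q qp by auto
    have "p > 1" using q qp prime_gt_1_nat by blast
    then have "m < n" "m > 0" using m less.prems(1) by auto
    then obtain k where "m = p ^ k" using less m by (metis dvd_mult)
    then show ?thesis using m by (intro exI[of _ "Suc k"]) simp
  qed
qed

section \<open>Cycle lengths under the chain condition\<close>

locale orbit_chain = faithful_action +
  assumes chain: "\<lbrakk>g \<in> carrier G; h \<in> carrier G\<rbrakk> \<Longrightarrow>
    (\<forall>x\<in>E. \<exists>i::int. \<phi> g x = \<phi> (h [^] i) x) \<or> (\<forall>x\<in>E. \<exists>i::int. \<phi> h x = \<phi> (g [^] i) x)"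
begin

sublocale group G
  using group_hom by (rule group_hom.axioms(1))

text \<open>The pointwise form of refinement: every cycle of \<open>g\<close> lies in a cycle of
  \<open>h\<close>.\<close>

definition below :: "'a \<Rightarrow> 'a \<Rightarrow> bool" where
  "below g h \<longleftrightarrow> (\<forall>x\<in>E. \<exists>i::int. \<phi> g x = \<phi> (h [^] i) x)"

text \<open>The generator of the stabiliser of \<open>x\<close>, taken as a subgroup of the
  integers. The value 0 stands for an infinite cycle and needs no separate treatment in this
  form.\<close>

definition period :: "'a \<Rightarrow> 'c \<Rightarrow> nat" where
  "period g x = (SOME n. \<forall>i::int. \<phi> (g [^] i) x = x \<longleftrightarrow> int n dvd i)"

lemma below_linear: "\<lbrakk>g \<in> carrier G; h \<in> carrier G\<rbrakk> \<Longrightarrow> below g h \<or> below h g"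
  using chain unfolding below_def by blast

lemma act_closed [simp]: "\<lbrakk>g \<in> carrier G; x \<in> E\<rbrakk> \<Longrightarrow> \<phi> g x \<in> E"
  using element_image by blast

lemma act_one [simp]: "x \<in> E \<Longrightarrow> \<phi> \<one> x = x"
  by (metis id_eq_one restrict_apply')

lemma act_inv: "\<lbrakk>g \<in> carrier G; x \<in> E\<rbrakk> \<Longrightarrow> \<phi> (inv g) (\<phi> g x) = x"
  using orbit_sym_aux by blast

lemma act_inj: "\<lbrakk>g \<in> carrier G; x \<in> E; y \<in> E\<rbrakk> \<Longrightarrow> \<phi> g x = \<phi> g y \<longleftrightarrow> x = y"
  by (metis act_inv)

lemma act_pow_add:
  "\<lbrakk>g \<in> carrier G; x \<in> E\<rbrakk> \<Longrightarrow> \<phi> (g [^] (i + j::int)) x = \<phi> (g [^] i) (\<phi> (g [^] j) x)"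
  by (simp add: int_pow_mult composition_rule)

lemma act_pow_cancel:
  assumes "g \<in> carrier G" "x \<in> E" "y \<in> E"
  shows "\<phi> (g [^] (- i::int)) y = x \<longleftrightarrow> y = \<phi> (g [^] i) x"
proof -
  have "\<phi> (g [^] i) (\<phi> (g [^] (- i)) y) = y" "\<phi> (g [^] (- i)) (\<phi> (g [^] i) x) = x"
    using act_pow_add[of g y i "- i"] act_pow_add[of g x "- i" i] assms by auto
  then show ?thesis by metis
qed

lemma eq_if_act_eq:
  assumes "g \<in> carrier G" "h \<in> carrier G" "\<And>x. x \<in> E \<Longrightarrow> \<phi> g x = \<phi> h x"
  shows "g = h"
proof (rule inj_onD[OF faithful _ assms(1,2)])
  have "\<phi> g \<in> extensional E" "\<phi> h \<in> extensional E"
    using bij_prop0 assms unfolding Bij_def by auto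
  then show "\<phi> g = \<phi> h" using assms(3) by (rule extensionalityI)
qed

lemma period_iff:
  assumes "g \<in> carrier G" "x \<in> E"
  shows "\<phi> (g [^] (i::int)) x = x \<longleftrightarrow> int (period g x) dvd i"
proof -
  define S where "S = {i::int. \<phi> (g [^] i) x = x}"
  have "\<exists>n. \<forall>i. i \<in> S \<longleftrightarrow> int n dvd i"
  proof (rule int_subgroup_multiples)
    show "0 \<in> S" using assms unfolding S_def by simp
    fix i j :: int assume "i \<in> S" "j \<in> S"
    then have i: "\<phi> (g [^] i) x = x" and j: "x = \<phi> (g [^] j) x" unfolding S_def by auto
    from j have "\<phi> (g [^] (- j)) x = x"
      by (rule iffD2[OF act_pow_cancel[OF assms assms(2)]])
    then have "\<phi> (g [^] (i + - j)) x = x"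
      using act_pow_add[OF assms, of i "- j"] i by (simp only:)
    then show "i - j \<in> S" unfolding S_def mem_Collect_eq by (simp only: diff_conv_add_uminus)
  qed
  then have "\<exists>n. \<forall>i::int. \<phi> (g [^] i) x = x \<longleftrightarrow> int n dvd i"
    by (simp only: S_def mem_Collect_eq)
  then have "\<forall>i::int. \<phi> (g [^] i) x = x \<longleftrightarrow> int (period g x) dvd i"
    unfolding period_def by (rule someI_ex)
  then show ?thesis by blast
qed

lemma period_eq_iff:
  assumes "g \<in> carrier G" "x \<in> E"
  shows "\<phi> (g [^] (i::int)) x = \<phi> (g [^] j) x \<longleftrightarrow> int (period g x) dvd i - j"
proof -
  have "\<phi> (g [^] (i - j)) x = \<phi> (g [^] (- j)) (\<phi> (g [^] i) x)"
    using act_pow_add[OF assms, of "- j" i] by simp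
  then show ?thesis
    using period_iff[OF assms, of "i - j"] act_pow_cancel[OF assms, of "\<phi> (g [^] i) x" j] assms
    by auto
qed

lemma period_dvd_nat_iff:
  assumes "g \<in> carrier G" "x \<in> E"
  shows "\<phi> (g [^] (n::nat)) x = x \<longleftrightarrow> period g x dvd n"
  using period_iff[OF assms, of "int n"] by (simp add: int_pow_int)

text \<open>If \<open>q\<close> and \<open>r\<close> differ, then neither of \<open>g [^] q\<close>
  and \<open>g [^] r\<close> lies below the other: evaluating one comparison at \<open>y\<close>
  gives \<open>r dvd q\<close>, and evaluating the other at \<open>x\<close> gives
  \<open>q dvd r\<close>.\<close>

lemma period_prime_unique_single:
  assumes "g \<in> carrier G" "x \<in> E" "y \<in> E"
    and "Factorial_Ring.prime q" "Factorial_Ring.prime r"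
    and "q dvd period g x" "r dvd period g y"
  shows "q = r"
proof -
  have aux: "b dvd a"
    if bel: "below (g [^] int a) (g [^] int b)" "z \<in> E" and "b dvd period g z" for a b z
  proof -
    obtain i :: int where "\<phi> (g [^] int a) z = \<phi> ((g [^] int b) [^] i) z"
      using bel unfolding below_def by blast
    then have "int (period g z) dvd int a - int b * i"
      using assms(1) bel(2) by (simp add: int_pow_pow period_eq_iff)
    then have "int b dvd int a - int b * i"
      using that(3) by (meson dvd_trans int_dvd_int_iff)
    then show ?thesis by (simp add: dvd_diff_left_iff)
  qed
  have "below (g [^] int q) (g [^] int r) \<or> below (g [^] int r) (g [^] int q)"
    using assms(1) by (intro below_linear) auto
  then have "r dvd q \<or> q dvd r" using aux assms by blast
  then show ?thesis using assms(4,5) primes_dvd_imp_eq by metis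
qed

lemma period_pos:
  assumes "g \<in> carrier G" "x \<in> E"
  shows "period g x > 0"
proof (rule ccontr)
  assume "\<not> period g x > 0"
  \<comment> \<open>A period 0 is divisible by both 2 and 3.\<close>
  then show False
    using period_prime_unique_single[of g x x 2 3] assms by auto
qed

text \<open>Together the two parts identify \<open>period g x\<close> with the length of the cycle
  through \<open>x\<close>; this is how statements about periods become statements about
  cycles.\<close>

lemma finite_cycle:
  assumes "g \<in> carrier G" "x \<in> E"
  shows "range (\<lambda>i::int. \<phi> (g [^] i) x) = (\<lambda>i::nat. \<phi> (g [^] i) x) ` {..<period g x}"
    and "inj_on (\<lambda>i::nat. \<phi> (g [^] i) x) {..<period g x}"
proof -
  have "\<phi> (g [^] i) x \<in> (\<lambda>i::nat. \<phi> (g [^] i) x) ` {..<period g x}" for i :: int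
  proof
    let ?j = "nat (i mod int (period g x))"
    show "?j \<in> {..<period g x}" using period_pos[OF assms] by (simp add: nat_less_iff)
    have "\<phi> (g [^] int ?j) x = \<phi> (g [^] i) x"
      using period_pos[OF assms] period_eq_iff[OF assms, of "int ?j" i] 
      by (simp add: mod_eq_dvd_iff[symmetric])
    then show "\<phi> (g [^] i) x = \<phi> (g [^] ?j) x" by (simp only: int_pow_int)
  qed
  then show "range (\<lambda>i::int. \<phi> (g [^] i) x) = (\<lambda>i::nat. \<phi> (g [^] i) x) ` {..<period g x}"
    by (fastforce simp flip: int_pow_int)
  show "inj_on (\<lambda>i::nat. \<phi> (g [^] i) x) {..<period g x}"
  proof (rule inj_onI)
    fix i j assume ij: "i \<in> {..<period g x}" "j \<in> {..<period g x}" "\<phi> (g [^] i) x = \<phi> (g [^] j) x"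
    then have "int (period g x) dvd int i - int j"
      using period_eq_iff[OF assms, of "int i" "int j"] by (simp add: int_pow_int)
    then show "i = j" using ij(1,2) by (auto simp: mod_eq_dvd_iff[symmetric])
  qed
qed

section \<open>Fixed points and commutativity\<close>

lemma act_pow_fixed:
  assumes "g \<in> carrier G" "x \<in> E" "\<phi> g x = x"
  shows "\<phi> (g [^] (i::int)) x = x"
proof -
  have "period g x = 1" using period_dvd_nat_iff[OF assms(1,2), of 1] assms by simp
  then show ?thesis using period_iff[OF assms(1,2)] by simp
qed

lemma belowD_fixed:
  assumes "below f h" "h \<in> carrier G" "x \<in> E" "\<phi> h x = x"
  shows "\<phi> f x = x"
  using assms act_pow_fixed[OF assms(2-4)] unfolding below_def by metis

text \<open>The fixed points of \<open>f\<close> and of \<open>h f h\<inverse>\<close> inside a cycle of \<open>h\<close> are finite sets of equal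
  size, and comparable by the chain condition; so the fixed points of \<open>f\<close> are \<open>h\<close>-invariant.\<close>

lemma below_fixed_cycle:
  assumes "f \<in> carrier G" "h \<in> carrier G" "below f h" "x \<in> E" "\<phi> f x = x"
  shows "\<phi> f (\<phi> (h [^] (i::int)) x) = \<phi> (h [^] i) x"
proof -
  define D where "D = range (\<lambda>i::int. \<phi> (h [^] i) x)"
  define F where "F = {y \<in> D. \<phi> f y = y}"
  define f' where "f' = h \<otimes> f \<otimes> inv h"
  have f': "f' \<in> carrier G" using assms by (simp add: f'_def)
  have D: "D \<subseteq> E" using assms unfolding D_def by auto
  have f'h: "\<phi> f' (\<phi> h y) = \<phi> h (\<phi> f y)" if "y \<in> E" for y
    using assms that by (simp add: f'_def composition_rule act_inv)
  have hD: "\<phi> h y \<in> D" if y: "y \<in> D" for y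
  proof -
    obtain i :: int where "y = \<phi> (h [^] i) x" using y unfolding D_def by auto
    then have "\<phi> h y = \<phi> (h [^] (1 + i)) x" using act_pow_add[of h x 1 i] assms by simp
    then show ?thesis unfolding D_def by blast
  qed
  have hD': "\<exists>z\<in>D. y = \<phi> h z" if y: "y \<in> D" for y
  proof -
    obtain i :: int where i: "y = \<phi> (h [^] i) x" using y unfolding D_def by auto
    have "y = \<phi> h (\<phi> (h [^] (i - 1)) x)"
      using i act_pow_add[of h x 1 "i - 1"] assms by simp
    then show ?thesis unfolding D_def by auto
  qed
  have F': "{y \<in> D. \<phi> f' y = y} = \<phi> h ` F"
  proof (intro equalityI subsetI)
    fix y assume y: "y \<in> {y \<in> D. \<phi> f' y = y}"
    then obtain z where z: "z \<in> D" "y = \<phi> h z" using hD' by blast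
    then have "\<phi> h (\<phi> f z) = \<phi> h z" using y f'h D by auto
    then have "\<phi> f z = z" using z D assms act_inj by (metis act_closed subsetD)
    then show "y \<in> \<phi> h ` F" using z unfolding F_def by auto
  qed (use f'h hD D in \<open>auto simp: F_def\<close>)
  have "finite D" using finite_cycle(1)[of h x] assms unfolding D_def by simp
  then have fin: "finite F" unfolding F_def by simp
  have "F \<subseteq> E" using D F_def by auto
  then have card: "card (\<phi> h ` F) = card F"
    using assms by (intro card_image inj_on_subset[OF inj_prop])
  have "F \<subseteq> {y \<in> D. \<phi> f' y = y} \<or> {y \<in> D. \<phi> f' y = y} \<subseteq> F"
    using below_linear[OF assms(1) f'] belowD_fixed assms f' D unfolding F_def by blast
  then have hF: "\<phi> h ` F = F"
    using card fin F' by (metis card_subset_eq finite_imageI)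
  have fwd: "\<phi> (h [^] (int n)) x \<in> F" for n
  proof (induction n)
    case 0
    then show ?case using assms hD unfolding F_def D_def by (auto intro!: range_eqI[of _ _ 0])
  next
    case (Suc n)
    have "\<phi> (h [^] int (Suc n)) x = \<phi> h (\<phi> (h [^] int n) x)"
      using act_pow_add[of h x 1 "int n"] assms by simp
    then show ?case using Suc hF by auto
  qed
  \<comment> \<open>\<open>fwd\<close> covers only exponents \<open>\<ge> 0\<close>; on a finite
    cycle these already reach every point.\<close>
  have "\<phi> (h [^] i) x \<in> range (\<lambda>i::int. \<phi> (h [^] i) x)" by blast
  then obtain n :: nat where "\<phi> (h [^] i) x = \<phi> (h [^] n) x"
    unfolding finite_cycle(1)[OF assms(2,4)] by blast
  then have "\<phi> (h [^] i) x \<in> F" using fwd[of n] by (simp add: int_pow_int)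
  then show ?thesis unfolding F_def by simp
qed

text \<open>The element \<open>h [^] (- j) \<otimes> g\<close> fixes \<open>x\<close>, hence by
  \<open>below_fixed_cycle\<close> the whole cycle of \<open>h\<close> through \<open>x\<close>,
  which means that \<open>g\<close> and \<open>h [^] j\<close> agree there.\<close>

lemma below_pow_on_cycle:
  assumes "g \<in> carrier G" "h \<in> carrier G" "below g h" "x \<in> E" "\<phi> g x = \<phi> (h [^] (j::int)) x"
  shows "\<phi> g (\<phi> (h [^] (i::int)) x) = \<phi> (h [^] j) (\<phi> (h [^] i) x)"
proof -
  define f where "f = h [^] (- j) \<otimes> g"
  have f: "f \<in> carrier G" using assms by (simp add: f_def)
  have fE: "\<phi> f y = y \<longleftrightarrow> \<phi> g y = \<phi> (h [^] j) y" if "y \<in> E" for y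
    using that assms act_pow_cancel[of h y "\<phi> g y" j] by (simp add: f_def composition_rule)
  have "\<phi> f (\<phi> (h [^] i) x) = \<phi> (h [^] i) x"
  proof (cases "below f h")
    case True
    then show ?thesis using below_fixed_cycle[of f h x i] assms f fE by simp
  next
    case False
    then have "below h f" using below_linear f assms by blast
    \<comment> \<open>Every fixed point of \<open>f\<close> is now fixed by \<open>h\<close>, so the
      cycle of \<open>h\<close> through \<open>x\<close> is a single point.\<close>
    then have "\<phi> h x = x" using belowD_fixed[of h f x] fE f assms by simp
    then show ?thesis using act_pow_fixed[of h x i] assms fE by simp
  qed
  then show ?thesis using fE assms by simp
qed

text \<open>On each cycle of \<open>h\<close>, \<open>g\<close> coincides with a power of
  \<open>h\<close>, and such a power commutes with \<open>h\<close>.\<close>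

lemma below_commute:
  assumes "g \<in> carrier G" "h \<in> carrier G" "below g h"
  shows "g \<otimes> h = h \<otimes> g"
proof (rule eq_if_act_eq)
  fix x assume x: "x \<in> E"
  then obtain j :: int where j: "\<phi> g x = \<phi> (h [^] j) x"
    using assms unfolding below_def by blast
  have "\<phi> g (\<phi> h x) = \<phi> (h [^] j) (\<phi> h x)"
    using below_pow_on_cycle[OF assms x j, of 1] assms by simp
  also have "\<dots> = \<phi> h (\<phi> (h [^] j) x)"
    using act_pow_add[of h x j 1] act_pow_add[of h x 1 j] assms x by (simp add: add.commute)
  finally show "\<phi> (g \<otimes> h) x = \<phi> (h \<otimes> g) x" using x j assms by (simp add: composition_rule)
qed (use assms in auto)

sublocale comm_group G
proof
  fix g h assume "g \<in> carrier G" "h \<in> carrier G"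
  then show "g \<otimes> h = h \<otimes> g" using below_linear below_commute by metis
qed

lemma act_commute:
  "\<lbrakk>g \<in> carrier G; h \<in> carrier G; x \<in> E\<rbrakk> \<Longrightarrow> \<phi> g (\<phi> h x) = \<phi> h (\<phi> g x)"
  by (metis composition_rule m_comm)

section \<open>One prime for the whole group, and exponents on different cycles\<close>

lemma act_pow_eq_pow:
  assumes "g \<in> carrier G" "h \<in> carrier G" "x \<in> E" "\<phi> g x = \<phi> (h [^] (j::int)) x"
  shows "\<phi> (g [^] (n::nat)) x = \<phi> (h [^] (j * int n)) x"
proof (induction n)
  case (Suc n)
  have "\<phi> (g [^] Suc n) x = \<phi> (g [^] n) (\<phi> (h [^] j) x)"
    using assms by (simp add: composition_rule)
  also have "\<dots> = \<phi> (h [^] j) (\<phi> (g [^] n) x)" using assms by (simp add: act_commute)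
  also have "\<dots> = \<phi> (h [^] (j * int (Suc n))) x"
    using Suc assms act_pow_add[of h x j "j * int n"] by (simp add: algebra_simps)
  finally show ?case .
qed (use assms in simp)

lemma period_dvd_if_eq_pow:
  assumes "g \<in> carrier G" "h \<in> carrier G" "x \<in> E" "\<phi> g x = \<phi> (h [^] (j::int)) x"
  shows "period g x dvd period h x"
proof -
  have "\<phi> (g [^] period h x) x = \<phi> (h [^] (j * int (period h x))) x"
    using act_pow_eq_pow[OF assms] .
  moreover have "\<phi> (h [^] (j * int (period h x))) x = x"
    using assms by (simp add: period_iff)
  ultimately have "\<phi> (g [^] period h x) x = x" by (simp only:)
  then show ?thesis using assms by (simp add: period_dvd_nat_iff)
qed

text \<open>For \<open>g\<close> below \<open>h\<close>, periods of \<open>g\<close> divide those of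
  \<open>h\<close> at the same point. Both primes then divide periods of the single element
  \<open>h\<close>.\<close>

lemma period_prime_unique:
  assumes "g \<in> carrier G" "h \<in> carrier G" "x \<in> E" "y \<in> E"
    and "Factorial_Ring.prime q" "Factorial_Ring.prime r"
    and "q dvd period g x" "r dvd period h y"
  shows "q = r"
proof -
  have aux: "q = r" if bel: "below g h" "x \<in> E" and "g \<in> carrier G" "h \<in> carrier G" "y \<in> E"
     "Factorial_Ring.prime q" "Factorial_Ring.prime r" "q dvd period g x" "r dvd period h y"
   for g h x y q r
  proof -
    obtain j :: int where "\<phi> g x = \<phi> (h [^] j) x" using bel unfolding below_def by blast
    then have "q dvd period h x" using period_dvd_if_eq_pow[of g h x j] that dvd_trans by blast
    then show ?thesis using period_prime_unique_single[of h x y q r] that by blast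
  qed
  show ?thesis using below_linear[OF assms(1,2)] aux assms by metis
qed

lemma ex_prime_periods:
  "\<exists>p. Factorial_Ring.prime p \<and> (\<forall>g\<in>carrier G. \<forall>x\<in>E. \<exists>k. period g x = p ^ k)"
proof (cases "\<exists>g\<in>carrier G. \<exists>x\<in>E. period g x \<noteq> 1")
  case True
  then obtain g x where g: "g \<in> carrier G" "x \<in> E" "period g x \<noteq> 1" by blast
  then obtain p where p: "Factorial_Ring.prime p" "p dvd period g x"
    using prime_factor_nat by blast
  have "\<exists>k. period h y = p ^ k" if h: "h \<in> carrier G" "y \<in> E" for h y
  proof (rule prime_power_if_unique_prime)
    show "period h y > 0" using period_pos h by blast
    show "q = p" if "Factorial_Ring.prime q" "q dvd period h y" for q
      using period_prime_unique[OF h(1) g(1) h(2) g(2) that(1) p(1) that(2) p(2)] .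
  qed
  then show ?thesis using p by blast
next
  case False
  \<comment> \<open>All periods are 1, the zeroth power of any prime; 2 is an arbitrary
    choice.\<close>
  then show ?thesis by (intro exI[of _ 2]) (metis power_0 two_is_prime_nat)
qed

text \<open>If \<open>f'\<close> lay below \<open>f\<close> it would fix \<open>x\<close>. Hence
  \<open>f\<close> lies below \<open>f'\<close> and inherits its fixed points.\<close>

lemma fixed_chain:
  assumes "f \<in> carrier G" "f' \<in> carrier G" "x \<in> E" "y \<in> E"
    and "\<phi> f x = x" "\<phi> f' x \<noteq> x" "\<phi> f' y = y"
  shows "\<phi> f y = y"
  using below_linear[of f f'] belowD_fixed[of f' f x] belowD_fixed[of f f' y] assms by metis

text \<open>The elements \<open>f\<close> and \<open>f'\<close> record where \<open>h\<close> agrees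
  with \<open>g [^] j\<close> and with \<open>g [^] i\<close>. If \<open>f\<close> moved
  \<open>x\<close>, then \<open>fixed_chain\<close> would make \<open>f'\<close> fix
  \<open>y\<close>; so \<open>i\<close> and \<open>j\<close> would agree modulo
  \<open>period g y\<close>, hence modulo \<open>period g x\<close>, and \<open>f\<close> would fix
  \<open>x\<close> after all.\<close>

lemma pow_transfer:
  assumes "g \<in> carrier G" "h \<in> carrier G" "x \<in> E" "y \<in> E"
    and hx: "\<phi> h x = \<phi> (g [^] (i::int)) x" and "period g x dvd period g y"
    and hy: "\<phi> h y = \<phi> (g [^] (j::int)) y"
  shows "\<phi> h x = \<phi> (g [^] j) x"
proof (rule ccontr)
  assume neq: "\<phi> h x \<noteq> \<phi> (g [^] j) x"
  define f where "f = g [^] (- j) \<otimes> h"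
  define f' where "f' = g [^] (- i) \<otimes> h"
  have c: "f \<in> carrier G" "f' \<in> carrier G" using assms by (auto simp: f_def f'_def)
  have fE: "\<phi> f z = z \<longleftrightarrow> \<phi> h z = \<phi> (g [^] j) z" "\<phi> f' z = z \<longleftrightarrow> \<phi> h z = \<phi> (g [^] i) z"
    if "z \<in> E" for z
    using that assms act_pow_cancel[of g z "\<phi> h z"] by (simp_all add: f_def f'_def composition_rule)
  have "\<phi> f' y = y"
    by (rule fixed_chain[of f' f x y]) (use assms neq c fE in auto)
  then have "int (period g y) dvd i - j"
    using fE hy assms period_eq_iff[of g y i j] by simp
  then have "int (period g x) dvd i - j"
    using assms(6) by (meson dvd_trans int_dvd_int_iff)
  then show False using period_eq_iff[of g x i j] assms neq by simp
qed

end

section \<open>Finite order read off from cycle lengths\<close>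

context orbit_chain
begin

lemma pow_eq_one_iff:
  assumes "g \<in> carrier G"
  shows "g [^] (n::nat) = \<one> \<longleftrightarrow> (\<forall>x\<in>E. period g x dvd n)"
proof -
  have "g [^] n = \<one> \<longleftrightarrow> (\<forall>x\<in>E. \<phi> (g [^] n) x = x)"
    using assms eq_if_act_eq[of "g [^] n" \<one>] by auto
  then show ?thesis using assms by (simp add: period_dvd_nat_iff)
qed

lemma below_finite_order:
  assumes "g \<in> carrier G" "h \<in> carrier G" "below g h" "finite_order G h"
  shows "finite_order G g"
proof -
  obtain n :: nat where n: "n > 0" "\<forall>x\<in>E. period h x dvd n"
    using assms unfolding finite_order_def by (auto simp: pow_eq_one_iff)
  have "period g x dvd n" if x: "x \<in> E" for x
  proof -
    obtain j :: int where "\<phi> g x = \<phi> (h [^] j) x" using assms x unfolding below_def by blast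
    then show ?thesis using period_dvd_if_eq_pow assms n x dvd_trans by blast
  qed
  then show ?thesis using n assms unfolding finite_order_def by (auto simp: pow_eq_one_iff)
qed

text \<open>Every element of \<open>G\<close> commutes with \<open>g\<close> and so carries cycles
  of \<open>g\<close> to cycles of \<open>g\<close> of the same length.\<close>

lemma period_orbit:
  assumes "g \<in> carrier G" "x \<in> E" "y \<in> orbit G \<phi> x"
  shows "period g y = period g x"
proof -
  have *: "period g (\<phi> h x) dvd period g x" if h: "h \<in> carrier G" "x \<in> E" for h x
  proof -
    have "\<phi> (g [^] period g x) x = x"
      using h assms(1) by (simp add: period_dvd_nat_iff)
    then have "\<phi> (g [^] period g x) (\<phi> h x) = \<phi> h x"
      using h assms(1) by (metis act_commute nat_pow_closed)
    then show ?thesis using h assms(1) by (simp add: period_dvd_nat_iff)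
  qed
  obtain h where h: "h \<in> carrier G" "y = \<phi> h x" using assms unfolding orbit_def by auto
  then have "x = \<phi> (inv h) y" "y \<in> E" using assms by (simp_all add: act_inv)
  then show ?thesis using *[of h x] *[of "inv h" y] h assms by (auto intro: dvd_antisym)
qed

text \<open>Each orbit contributes one period, so only finitely many periods occur, and their
  product is an exponent of \<open>g\<close>. The contrapositive yields infinitely many orbits in
  the torsion-free case.\<close>

lemma finite_order_if_finite_orbits:
  assumes "g \<in> carrier G" "finite (orbits G E \<phi>)"
  shows "finite_order G g"
proof -
  have "period g ` E \<subseteq> (\<lambda>Y. period g (SOME y. y \<in> Y)) ` orbits G E \<phi>"
  proof
    fix n assume "n \<in> period g ` E"
    then obtain x where x: "x \<in> E" "n = period g x" by auto
    have "(SOME y. y \<in> orbit G \<phi> x) \<in> orbit G \<phi> x"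
      using orbit_refl[OF x(1)] by (rule someI)
    then have "period g (SOME y. y \<in> orbit G \<phi> x) = n"
      using period_orbit assms x by blast
    then show "n \<in> (\<lambda>Y. period g (SOME y. y \<in> Y)) ` orbits G E \<phi>"
      using x unfolding orbits_def by blast
  qed
  then have fin: "finite (period g ` E)" using assms finite_surj by blast
  have "prod id (period g ` E) > 0"
    using period_pos assms by (intro prod_pos) auto
  moreover have "period g x dvd prod id (period g ` E)" if "x \<in> E" for x
    using dvd_prodI[OF fin, of "period g x" id] that by simp
  ultimately show ?thesis using assms pow_eq_one_iff unfolding finite_order_def by blast
qed

lemma pow_period_on_orbit:
  assumes "g \<in> carrier G" "x \<in> E" "y \<in> orbit G \<phi> x"
  shows "\<phi> (g [^] period g x) y = y"
proof -
  have "y \<in> E" using assms unfolding orbit_def by auto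
  then show ?thesis using period_orbit[OF assms] period_dvd_nat_iff assms by simp
qed

end

section \<open>Periodic or torsion-free\<close>

locale orbit_chain_prime = orbit_chain +
  fixes p :: nat
  assumes prime_p: "Factorial_Ring.prime p"
    and period_power: "\<lbrakk>g \<in> carrier G; x \<in> E\<rbrakk> \<Longrightarrow> \<exists>k. period g x = p ^ k"
begin

lemma p_gt_1: "p > 1"
  using prime_p prime_gt_1_nat by blast

lemma period_dvd_linear:
  assumes "g \<in> carrier G" "x \<in> E" "y \<in> E" "period g x \<le> period g y"
  shows "period g x dvd period g y"
proof -
  obtain k l where kl: "period g x = p ^ k" "period g y = p ^ l"
    using period_power assms by metis
  then have "k \<le> l" using assms(4) p_gt_1 power_le_imp_le_exp by metis
  then show ?thesis using kl by (simp add: le_imp_power_dvd)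
qed

lemma finite_order_pow_prime:
  assumes "g \<in> carrier G" "finite_order G g"
  obtains k where "g [^] (p ^ k) = \<one>"
proof -
  obtain n :: nat where n: "n > 0" "\<forall>x\<in>E. period g x dvd n"
    using assms unfolding finite_order_def by (auto simp: pow_eq_one_iff)
  \<comment> \<open>The exponent \<open>n\<close> is crude but sufficient: a period
    \<open>p ^ k\<close> dividing \<open>n\<close> has \<open>k < p ^ k \<le> n\<close>.\<close>
  have "period g x dvd p ^ n" if x: "x \<in> E" for x
  proof -
    obtain k where k: "period g x = p ^ k" using period_power assms x by blast
    have "k < p ^ k" using p_gt_1 by (simp add: power_gt_expt)
    also have "p ^ k \<le> n" using n x k dvd_imp_le by metis
    finally show ?thesis using k by (simp add: le_imp_power_dvd)
  qed
  then show ?thesis using that[of n] assms by (simp add: pow_eq_one_iff)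
qed

lemma ord_prime_power:
  assumes "g \<in> carrier G" "finite_order G g"
  obtains k where "ord g = p ^ k"
proof -
  obtain n where "g [^] (p ^ n) = \<one>" using finite_order_pow_prime assms by blast
  then have "ord g dvd p ^ n" using assms by (simp add: pow_eq_id)
  then show ?thesis using that divides_primepow_nat[OF prime_p] by blast
qed

text \<open>Take a point \<open>x\<close> moved by \<open>g\<close>. A suitable
  \<open>h [^] (p ^ n)\<close> fixes \<open>x\<close>, so \<open>g\<close> cannot lie below it, and
  linearity leaves only the other direction.\<close>

lemma below_some_power:
  assumes "g \<in> carrier G" "g \<noteq> \<one>" "h \<in> carrier G"
  obtains n where "below (h [^] (p ^ n)) g"
proof -
  obtain x where x: "x \<in> E" "\<phi> g x \<noteq> x" using eq_if_act_eq[of g \<one>] assms by auto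
  obtain n where "period h x = p ^ n" using period_power assms x by blast
  then have "\<phi> (h [^] (p ^ n)) x = x" using period_dvd_nat_iff[of h x "p ^ n"] assms x by simp
  then have "\<not> below g (h [^] (p ^ n))" using belowD_fixed[of g "h [^] (p ^ n)" x] assms x by auto
  then show ?thesis using that below_linear[of g "h [^] (p ^ n)"] assms by auto
qed

text \<open>Some power of an element of infinite order would lie below a nontrivial element of
  finite order, and so have finite order itself.\<close>

lemma periodic_or_torsion_free: "periodic G \<or> torsion_free G"
proof (rule ccontr)
  assume "\<not> (periodic G \<or> torsion_free G)"
  then obtain g h where gh: "g \<in> carrier G" "g \<noteq> \<one>" "finite_order G g"
    "h \<in> carrier G" "\<not> finite_order G h"
    unfolding periodic_def torsion_free_def by blast
  then obtain n where "below (h [^] (p ^ n)) g" using below_some_power by metis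
  then have "finite_order G (h [^] (p ^ n))"
    using below_finite_order[of "h [^] (p ^ n)" g] gh by simp
  then obtain m :: nat where "m > 0" "h [^] (p ^ n * m) = \<one>"
    using gh unfolding finite_order_def by (auto simp: nat_pow_pow)
  then have "finite_order G h"
    unfolding finite_order_def using p_gt_1 by (intro exI[of _ "p ^ n * m"]) auto
  then show False using gh by simp
qed

lemma below_imp_power:
  assumes "g \<in> carrier G" "h \<in> carrier G" "below g h" "finite_order G h"
  shows "\<exists>j::int. g = h [^] j"
proof (cases "E = {}")
  case True
  \<comment> \<open>A faithful group on the empty set is trivial, so any exponent works.\<close>
  then show ?thesis using eq_if_act_eq[of g "h [^] (0::int)"] assms by blast
next
  case False
  obtain n :: nat where n: "n > 0" "\<forall>x\<in>E. period h x dvd n"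
    using assms unfolding finite_order_def by (auto simp: pow_eq_one_iff)
  then have bound: "\<forall>x. x \<in> E \<longrightarrow> period h x < Suc n" by (auto intro: dvd_imp_le le_imp_less_Suc)
  obtain x0 where "x0 \<in> E" using False by blast
  \<comment> \<open>A longest cycle exists because all lengths divide \<open>n\<close>.\<close>
  then obtain x where x: "x \<in> E" "\<forall>y. y \<in> E \<longrightarrow> period h y \<le> period h x"
    using ex_has_greatest_nat[of "\<lambda>x. x \<in> E", OF _ bound] by blast
  obtain j :: int where j: "\<phi> g x = \<phi> (h [^] j) x" using assms x unfolding below_def by blast
  have "\<phi> g y = \<phi> (h [^] j) y" if y: "y \<in> E" for y
  proof -
    obtain i :: int where i: "\<phi> g y = \<phi> (h [^] i) y" using assms y unfolding below_def by blast
    have "period h y dvd period h x" using period_dvd_linear x y assms by blast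
    then show ?thesis using pow_transfer[OF assms(2,1) y x(1) i _ j] by blast
  qed
  then have "g = h [^] j" using assms by (intro eq_if_act_eq) auto
  then show ?thesis by blast
qed

end

section \<open>The additive group of the p-adic numbers\<close>

text \<open>This says that the \<open>p\<close>-adic valuation of \<open>x\<close> is at least
  \<open>k\<close>. The fraction need not be reduced and \<open>x = 0\<close> is covered, so closure
  under sums is plain fraction arithmetic and no ultrametric inequality for \<open>padic_abs\<close>
  has to be proved.\<close>

definition padic_ge :: "nat \<Rightarrow> int \<Rightarrow> rat \<Rightarrow> bool" where
  "padic_ge p k x \<longleftrightarrow>
     (\<exists>a b::int. \<not> int p dvd b \<and> x = of_nat p powi k * (of_int a / of_int b))"

context
  fixes p :: nat
  assumes p: "Factorial_Ring.prime p"
begin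

lemma padic_ge_zero: "padic_ge p k 0"
  unfolding padic_ge_def using p not_prime_unit
  by (intro exI[of _ 0] exI[of _ 1]) auto

lemma padic_ge_add:
  assumes "padic_ge p k x" "padic_ge p k y"
  shows "padic_ge p k (x + y)"
proof -
  obtain a b c d where ab: "\<not> int p dvd b" "x = of_nat p powi k * (of_int a / of_int b)"
    and cd: "\<not> int p dvd d" "y = of_nat p powi k * (of_int c / of_int d)"
    using assms unfolding padic_ge_def by blast
  have "b \<noteq> 0" "d \<noteq> 0" using ab cd by auto
  then have "x + y = of_nat p powi k * (of_int (a * d + c * b) / of_int (b * d))"
    unfolding ab cd by (simp add: field_simps)
  moreover have "\<not> int p dvd b * d" using ab cd p by (simp add: prime_dvd_mult_iff)
  ultimately show ?thesis unfolding padic_ge_def by blast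
qed

lemma padic_ge_mult_int:
  assumes "padic_ge p k x"
  shows "padic_ge p k (of_int m * x)"
proof -
  obtain a b where ab: "\<not> int p dvd b" "x = of_nat p powi k * (of_int a / of_int b)"
    using assms unfolding padic_ge_def by blast
  then have "of_int m * x = of_nat p powi k * (of_int (m * a) / of_int b)" by simp
  then show ?thesis using ab unfolding padic_ge_def by blast
qed

lemma padic_ge_minus: "padic_ge p k x \<Longrightarrow> padic_ge p k (- x)"
  using padic_ge_mult_int[of k x "-1"] by simp

lemma padic_ge_diff: "\<lbrakk>padic_ge p k x; padic_ge p k y\<rbrakk> \<Longrightarrow> padic_ge p k (x - y)"
  using padic_ge_add[OF _ padic_ge_minus] by fastforce

text \<open>Congruences modulo \<open>p ^ k\<close> between integer exponents enter the
  \<open>p\<close>-adic estimates through this equivalence.\<close>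

lemma padic_ge_int_iff: "padic_ge p (int k) (of_int m) \<longleftrightarrow> int (p ^ k) dvd m"
proof
  assume "padic_ge p (int k) (of_int m)"
  then obtain a b where ab: "\<not> int p dvd b" "of_int m = of_nat p ^ k * (of_int a / of_int b :: rat)"
    unfolding padic_ge_def by auto
  have "b \<noteq> 0" using ab by auto
  then have "(of_int (m * b) :: rat) = of_int (int p ^ k * a)"
    using ab by (simp add: field_simps)
  then have "m * b = int p ^ k * a" by (simp only: of_int_eq_iff)
  then have "int p ^ k dvd m * b" by simp
  moreover have "coprime (int p ^ k) b" using ab(1) p by (simp add: prime_imp_coprime)
  ultimately show "int (p ^ k) dvd m" by (simp add: coprime_dvd_mult_left_iff)
next
  assume "int (p ^ k) dvd m"
  then obtain a where "m = int p ^ k * a" by auto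
  then show "padic_ge p (int k) (of_int m)"
    unfolding padic_ge_def using p not_prime_unit by (intro exI[of _ a] exI[of _ 1]) auto
qed

lemma padic_ge_shift:
  "padic_ge p k x \<Longrightarrow> padic_ge p (k - int n) (x / of_nat (p ^ n))"
proof -
  assume "padic_ge p k x"
  then obtain a b where ab: "\<not> int p dvd b" "x = of_nat p powi k * (of_int a / of_int b)"
    unfolding padic_ge_def by blast
  have "(of_nat p :: rat) \<noteq> 0" using p by (auto simp: not_prime_0)
  then have "x / of_nat (p ^ n) = of_nat p powi (k - int n) * (of_int a / of_int b)"
    unfolding ab by (simp add: power_int_diff)
  then show ?thesis using ab unfolding padic_ge_def by blast
qed

lemma padic_ge_mono:
  assumes "padic_ge p k x" "l \<le> k"
  shows "padic_ge p l x"
proof -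
  obtain a b where ab: "\<not> int p dvd b" "x = of_nat p powi k * (of_int a / of_int b)"
    using assms unfolding padic_ge_def by blast
  have "(of_nat p :: rat) \<noteq> 0" using p by (auto simp: not_prime_0)
  moreover have "k = l + int (nat (k - l))" using assms by simp
  ultimately have "(of_nat p :: rat) powi k = of_nat p powi l * of_nat p ^ nat (k - l)"
    by (metis power_int_add power_int_of_nat)
  then have "x = of_nat p powi l * (of_int (int p ^ nat (k - l) * a) / of_int b)"
    unfolding ab by simp
  then show ?thesis using ab unfolding padic_ge_def by blast
qed

text \<open>Extracting all factors \<open>p\<close> from numerator and denominator writes
  \<open>x\<close> as the power of \<open>p\<close> with exponent \<open>m - n\<close> times a
  fraction of integers prime to \<open>p\<close>; both sides then say
  \<open>k \<le> m - n\<close>.\<close>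

lemma padic_abs_le_iff: "padic_abs p x \<le> real p powi (- k) \<longleftrightarrow> padic_ge p k x"
proof (cases "x = 0")
  case True
  then show ?thesis using padic_ge_zero by (simp add: padic_abs_def)
next
  case False
  have p1: "real p > 1" using p prime_gt_1_nat by simp
  have p0: "(of_nat p :: rat) \<noteq> 0" using p by (auto simp: not_prime_0)
  have pi: "Factorial_Ring.prime (int p)" using p by simp
  then have unit: "\<not> is_unit (int p)" using not_prime_unit by blast
  obtain a b where ab: "quotient_of x = (a, b)" by fastforce
  then have x: "x = of_int a / of_int b" and b: "b \<noteq> 0"
    using quotient_of_div quotient_of_denom_pos by fastforce+
  then have a: "a \<noteq> 0" using False by auto
  define m where "m = multiplicity (int p) a"
  define n where "n = multiplicity (int p) b"
  obtain a' where a': "a = int p ^ m * a'" "\<not> int p dvd a'"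
    using multiplicity_decompose'[OF a unit] unfolding m_def by (metis mult.commute)
  obtain b' where b': "b = int p ^ n * b'" "\<not> int p dvd b'"
    using multiplicity_decompose'[OF b unit] unfolding n_def by (metis mult.commute)
  have x': "x = of_nat p powi (int m - int n) * (of_int a' / of_int b')"
    unfolding x a'(1) b'(1) using p0 by (simp add: power_int_diff)
  have "padic_abs p x = real p powi (int n - int m)"
    using ab False unfolding padic_abs_def m_def n_def by simp
  then have "padic_abs p x \<le> real p powi (- k) \<longleftrightarrow> k \<le> int m - int n"
    using p1 power_int_increasing[of "int n - int m" "- k" "real p"]
      power_int_strict_increasing[of "- k" "int n - int m" "real p"] by linarith
  also have "\<dots> \<longleftrightarrow> padic_ge p k x"
  proof
    assume le: "k \<le> int m - int n"
    have "padic_ge p (int m - int n) x" unfolding padic_ge_def using x' b' by blast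
    then show "padic_ge p k x" using padic_ge_mono le by blast
  next
    assume "padic_ge p k x"
    then obtain c d where cd: "\<not> int p dvd d" "x = of_nat p powi k * (of_int c / of_int d)"
      unfolding padic_ge_def by blast
    show "k \<le> int m - int n"
    proof (rule ccontr)
      assume "\<not> k \<le> int m - int n"
      \<comment> \<open>With \<open>k\<close> too large by \<open>Suc e\<close>, cancelling the
        common power of \<open>p\<close> leaves a factor \<open>p\<close> in \<open>a' * d\<close>,
        although \<open>p\<close> divides neither \<open>a'\<close> nor \<open>d\<close>.\<close>
      then obtain e where e: "k = int m - int n + int (Suc e)"
        by (metis add_diff_cancel_left' diff_add_cancel linorder_not_le zless_iff_Suc_zadd)
      have "(of_nat p :: rat) powi k = of_nat p powi (int m - int n) * of_nat p ^ Suc e"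
        unfolding e using p0 power_int_add[of "of_nat p :: rat" "int m - int n" "int (Suc e)"]
        by (simp only: power_int_of_nat) simp
      then have "of_nat p powi (int m - int n) * (of_int a' / of_int b' :: rat)
          = of_nat p powi (int m - int n) * (of_nat p ^ Suc e * (of_int c / of_int d))"
        using cd x' by (simp only: mult.assoc)
      then have "(of_int a' / of_int b' :: rat) = of_nat p ^ Suc e * (of_int c / of_int d)"
        using p0 by (simp only: mult_cancel_left power_int_eq_0_iff) blast
      moreover have "d \<noteq> 0" "b' \<noteq> 0" using cd b' by auto
      ultimately have "(of_int (a' * d) :: rat) = of_int (int p * (int p ^ e * c * b'))"
        by (simp add: field_simps)
      then have "a' * d = int p * (int p ^ e * c * b')" by (simp only: of_int_eq_iff)
      then have "int p dvd a' * d" by simp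
      then show False using pi a' cd by (simp add: prime_dvd_mult_iff)
    qed
  qed
  finally show ?thesis .
qed

lemma ex_prime_powi_less:
  fixes e :: real
  assumes "e > 0"
  shows "\<exists>k::nat. real p powi (- int k) < e"
proof -
  have "inverse (real p) < 1" using p prime_gt_1_nat by (simp add: inverse_less_1_iff)
  then obtain k where "inverse (real p) ^ k < e" using real_arch_pow_inv[OF assms] by blast
  then show ?thesis by (intro exI[of _ k]) (simp add: power_int_minus power_inverse)
qed

lemma padic_abs_less_imp_ge: "padic_abs p x < real p powi (- k) \<Longrightarrow> padic_ge p k x"
  using padic_abs_le_iff[of x k] by simp

lemma padic_abs_nonneg: "padic_abs p x \<ge> 0"
  unfolding padic_abs_def by (auto split: prod.split)

section \<open>Cauchy sequences modulo null sequences\<close>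

lemma padic_Cauchy_iff:
  "padic_Cauchy p s \<longleftrightarrow> (\<forall>k::nat. \<exists>N. \<forall>m\<ge>N. \<forall>n\<ge>N. padic_ge p (int k) (s m - s n))"
proof
  assume s: "padic_Cauchy p s"
  show "\<forall>k::nat. \<exists>N. \<forall>m\<ge>N. \<forall>n\<ge>N. padic_ge p (int k) (s m - s n)"
  proof
    fix k
    have "real p powi (- int k) > 0" using p prime_gt_0_nat by simp
    then show "\<exists>N. \<forall>m\<ge>N. \<forall>n\<ge>N. padic_ge p (int k) (s m - s n)"
      using s padic_abs_less_imp_ge unfolding padic_Cauchy_def by metis
  qed
next
  assume s: "\<forall>k::nat. \<exists>N. \<forall>m\<ge>N. \<forall>n\<ge>N. padic_ge p (int k) (s m - s n)"
  show "padic_Cauchy p s" unfolding padic_Cauchy_def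
  proof (intro allI impI)
    fix e :: real assume "e > 0"
    then obtain k where "real p powi (- int k) < e" using ex_prime_powi_less by blast
    then show "\<exists>N. \<forall>m\<ge>N. \<forall>n\<ge>N. padic_abs p (s m - s n) < e"
      using s by (meson le_less_trans padic_abs_le_iff)
  qed
qed

lemma padic_null_iff:
  "s \<in> padic_null p \<longleftrightarrow> (\<forall>k::nat. \<exists>N. \<forall>n\<ge>N. padic_ge p (int k) (s n))"
proof
  assume s: "s \<in> padic_null p"
  show "\<forall>k::nat. \<exists>N. \<forall>n\<ge>N. padic_ge p (int k) (s n)"
  proof
    fix k
    have "real p powi (- int k) > 0" using p prime_gt_0_nat by simp
    then obtain N where "\<forall>n\<ge>N. \<bar>padic_abs p (s n)\<bar> < real p powi (- int k)"
      using s unfolding padic_null_def by (auto simp: LIMSEQ_iff)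
    then show "\<exists>N. \<forall>n\<ge>N. padic_ge p (int k) (s n)"
      using padic_abs_less_imp_ge by (meson abs_less_iff)
  qed
next
  assume s: "\<forall>k::nat. \<exists>N. \<forall>n\<ge>N. padic_ge p (int k) (s n)"
  have "\<exists>N. \<forall>n\<ge>N. norm (padic_abs p (s n) - 0) < e" if e: "e > 0" for e :: real
  proof -
    obtain k where "real p powi (- int k) < e" using ex_prime_powi_less e by blast
    then show ?thesis
      using s padic_abs_nonneg by (simp add: abs_of_nonneg) (meson le_less_trans padic_abs_le_iff)
  qed
  then show "s \<in> padic_null p" unfolding padic_null_def by (simp add: LIMSEQ_iff)
qed

lemma padic_null_diff:
  assumes "s \<in> padic_null p" "t \<in> padic_null p"
  shows "(\<lambda>n. s n - t n) \<in> padic_null p"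
  unfolding padic_null_iff
proof
  fix k
  obtain M N where "\<forall>n\<ge>M. padic_ge p (int k) (s n)" "\<forall>n\<ge>N. padic_ge p (int k) (t n)"
    using assms unfolding padic_null_iff by blast
  then show "\<exists>N. \<forall>n\<ge>N. padic_ge p (int k) (s n - t n)"
    by (intro exI[of _ "max M N"]) (auto intro: padic_ge_diff)
qed

lemma padic_Cauchy_diff:
  assumes "padic_Cauchy p s" "padic_Cauchy p t"
  shows "padic_Cauchy p (\<lambda>n. s n - t n)"
  unfolding padic_Cauchy_iff
proof
  fix k
  obtain M N where *: "\<forall>m\<ge>M. \<forall>n\<ge>M. padic_ge p (int k) (s m - s n)"
      "\<forall>m\<ge>N. \<forall>n\<ge>N. padic_ge p (int k) (t m - t n)"
    using assms unfolding padic_Cauchy_iff by blast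
  have "padic_ge p (int k) (s m - t m - (s n - t n))" if "m \<ge> max M N" "n \<ge> max M N" for m n
  proof -
    have "padic_ge p (int k) ((s m - s n) - (t m - t n))"
      by (rule padic_ge_diff) (use * that in auto)
    then show ?thesis by (simp add: algebra_simps)
  qed
  then show "\<exists>N. \<forall>m\<ge>N. \<forall>n\<ge>N. padic_ge p (int k) (s m - t m - (s n - t n))" by blast
qed

lemma padic_null_Cauchy:
  assumes "s \<in> padic_null p"
  shows "padic_Cauchy p s"
  unfolding padic_Cauchy_iff
proof
  fix k
  obtain N where "\<forall>n\<ge>N. padic_ge p (int k) (s n)" using assms unfolding padic_null_iff by blast
  then show "\<exists>N. \<forall>m\<ge>N. \<forall>n\<ge>N. padic_ge p (int k) (s m - s n)" by (auto intro: padic_ge_diff)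
qed

lemma padic_Cauchy_zero: "padic_Cauchy p (\<lambda>_. 0)"
  unfolding padic_Cauchy_iff using padic_ge_zero by simp

lemma padic_Cauchy_minus: "padic_Cauchy p s \<Longrightarrow> padic_Cauchy p (\<lambda>n. - s n)"
  using padic_Cauchy_diff[OF padic_Cauchy_zero] by simp

lemma padic_Cauchy_add: "\<lbrakk>padic_Cauchy p s; padic_Cauchy p t\<rbrakk> \<Longrightarrow> padic_Cauchy p (\<lambda>n. s n + t n)"
  using padic_Cauchy_diff[OF _ padic_Cauchy_minus] by fastforce

lemma padic_Cauchy_group: "comm_group (add_monoid (padic_Cauchy_ring p))"
proof (rule comm_groupI)
  fix s assume "s \<in> carrier (add_monoid (padic_Cauchy_ring p))"
  then show "\<exists>t\<in>carrier (add_monoid (padic_Cauchy_ring p)).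
      t \<otimes>\<^bsub>add_monoid (padic_Cauchy_ring p)\<^esub> s = \<one>\<^bsub>add_monoid (padic_Cauchy_ring p)\<^esub>"
    by (intro bexI[of _ "\<lambda>n. - s n"]) (auto simp: padic_Cauchy_ring_def padic_Cauchy_minus)
qed (auto simp: padic_Cauchy_ring_def padic_Cauchy_add padic_Cauchy_zero algebra_simps)

lemma padic_Cauchy_group_inv:
  assumes "padic_Cauchy p s"
  shows "inv\<^bsub>add_monoid (padic_Cauchy_ring p)\<^esub> s = (\<lambda>n. - s n)"
proof -
  interpret A: comm_group "add_monoid (padic_Cauchy_ring p)" by (rule padic_Cauchy_group)
  show ?thesis
    by (rule A.inv_equality) (use assms in \<open>auto simp: padic_Cauchy_ring_def padic_Cauchy_minus\<close>)
qed

lemma padic_null_normal: "padic_null p \<lhd> add_monoid (padic_Cauchy_ring p)"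
proof -
  interpret A: comm_group "add_monoid (padic_Cauchy_ring p)" by (rule padic_Cauchy_group)
  have zero: "(\<lambda>_. 0) \<in> padic_null p" unfolding padic_null_iff using padic_ge_zero by simp
  have minus: "(\<lambda>n. - s n) \<in> padic_null p" if "s \<in> padic_null p" for s
    using padic_null_diff[OF zero that] by simp
  have "subgroup (padic_null p) (add_monoid (padic_Cauchy_ring p))"
  proof (rule A.subgroupI)
    show "padic_null p \<subseteq> carrier (add_monoid (padic_Cauchy_ring p))"
      using padic_null_Cauchy by (auto simp: padic_Cauchy_ring_def)
    show "padic_null p \<noteq> {}" using zero by auto
    show "inv\<^bsub>add_monoid (padic_Cauchy_ring p)\<^esub> s \<in> padic_null p" if "s \<in> padic_null p" for s
      using that minus padic_null_Cauchy padic_Cauchy_group_inv by simp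
    show "s \<otimes>\<^bsub>add_monoid (padic_Cauchy_ring p)\<^esub> t \<in> padic_null p"
      if "s \<in> padic_null p" "t \<in> padic_null p" for s t
      using padic_null_diff[OF that(1) minus[OF that(2)]] by (simp add: padic_Cauchy_ring_def)
  qed
  then show ?thesis using A.normal_iff_subgroup by blast
qed

text \<open>The ring quotient and the group quotient have the same cosets and the same addition of
  sets, so group cosets suffice for the embedding.\<close>

lemma padic_field_add:
  "add_monoid (padic_field p) = add_monoid (padic_Cauchy_ring p) Mod padic_null p"
  unfolding padic_field_def FactRing_def FactGroup_def A_RCOSETS_def set_add_def by simp

text \<open>The element \<open>g\<close> goes to the class of \<open>s g\<close>. The sequences
  built later depend on choices and are additive only up to null sequences, which is all that the
  quotient requires.\<close>

lemma embeds_in_padic_field: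
  assumes "group G"
    and s: "\<And>g. g \<in> carrier G \<Longrightarrow> padic_Cauchy p (s g)"
    and add: "\<And>g h. \<lbrakk>g \<in> carrier G; h \<in> carrier G\<rbrakk> \<Longrightarrow>
          (\<lambda>n. s (g \<otimes>\<^bsub>G\<^esub> h) n - (s g n + s h n)) \<in> padic_null p"
    and inj: "\<And>g. \<lbrakk>g \<in> carrier G; s g \<in> padic_null p\<rbrakk> \<Longrightarrow> g = \<one>\<^bsub>G\<^esub>"
  shows "\<exists>H. subgroup H (add_monoid (padic_field p)) \<and>
           G \<cong> (add_monoid (padic_field p))\<lparr>carrier := H\<rparr>"
proof -
  interpret A: comm_group "add_monoid (padic_Cauchy_ring p)" by (rule padic_Cauchy_group)
  interpret N: normal "padic_null p" "add_monoid (padic_Cauchy_ring p)" by (rule padic_null_normal)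
  define \<psi> where "\<psi> g = padic_null p #>\<^bsub>add_monoid (padic_Cauchy_ring p)\<^esub> s g" for g
  let ?Q = "add_monoid (padic_Cauchy_ring p) Mod padic_null p"
  have carr: "t \<in> carrier (add_monoid (padic_Cauchy_ring p)) \<longleftrightarrow> padic_Cauchy p t" for t
    by (simp add: padic_Cauchy_ring_def)
  have coset_eq: "padic_null p #>\<^bsub>add_monoid (padic_Cauchy_ring p)\<^esub> t
      = padic_null p #>\<^bsub>add_monoid (padic_Cauchy_ring p)\<^esub> u"
    if t: "padic_Cauchy p t" "padic_Cauchy p u" "(\<lambda>n. t n - u n) \<in> padic_null p" for t u
  proof -
    have "t = (\<lambda>n. t n - u n) \<otimes>\<^bsub>add_monoid (padic_Cauchy_ring p)\<^esub> u"
      by (simp add: padic_Cauchy_ring_def)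
    then have "t \<in> padic_null p #>\<^bsub>add_monoid (padic_Cauchy_ring p)\<^esub> u"
      using t(3) unfolding r_coset_def by blast
    then show ?thesis using A.repr_independence[OF _ _ N.subgroup_axioms] t carr by simp
  qed
  have hom: "\<psi> \<in> hom G ?Q"
  proof (rule homI)
    fix g assume "g \<in> carrier G"
    then show "\<psi> g \<in> carrier ?Q"
      using s carr unfolding \<psi>_def carrier_FactGroup by blast
  next
    fix g h assume gh: "g \<in> carrier G" "h \<in> carrier G"
    have "g \<otimes>\<^bsub>G\<^esub> h \<in> carrier G" using gh assms(1) by (metis group.is_monoid monoid.m_closed)
    then have "\<psi> (g \<otimes>\<^bsub>G\<^esub> h) = padic_null p #>\<^bsub>add_monoid (padic_Cauchy_ring p)\<^esub> (\<lambda>n. s g n + s h n)"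
      unfolding \<psi>_def using gh s add by (intro coset_eq padic_Cauchy_add) auto
    also have "\<dots> = \<psi> g \<otimes>\<^bsub>?Q\<^esub> \<psi> h"
      unfolding \<psi>_def mult_FactGroup using N.rcos_sum[of "s g" "s h"] gh s carr
      by (simp add: padic_Cauchy_ring_def)
    finally show "\<psi> (g \<otimes>\<^bsub>G\<^esub> h) = \<psi> g \<otimes>\<^bsub>?Q\<^esub> \<psi> h" .
  qed
  interpret \<psi>: group_hom G ?Q \<psi>
    using assms(1) N.factorgroup_is_group hom by (simp add: group_hom_def group_hom_axioms_def)
  have "inj_on \<psi> (carrier G)"
  unfolding \<psi>.inj_on_one_iff
  proof (intro allI impI)
    fix g assume g: "g \<in> carrier G" "\<psi> g = \<one>\<^bsub>?Q\<^esub>"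
    then have "s g \<in> padic_null p"
      using A.rcos_self[OF _ N.subgroup_axioms, of "s g"] carr s unfolding \<psi>_def by auto
    then show "g = \<one>\<^bsub>G\<^esub>" using inj g by blast
  qed
  then have "\<psi> \<in> iso G (?Q\<lparr>carrier := \<psi> ` carrier G\<rparr>)"
    using hom by (auto simp: iso_def hom_def bij_betw_def)
  then show ?thesis
    unfolding padic_field_add using \<psi>.img_is_subgroup is_isoI by blast
qed

end

section \<open>The periodic case\<close>

lemma rat_group_comm_group: "comm_group rat_group"
proof (rule comm_groupI)
  fix x assume "x \<in> carrier rat_group"
  then show "\<exists>y\<in>carrier rat_group. y \<otimes>\<^bsub>rat_group\<^esub> x = \<one>\<^bsub>rat_group\<^esub>"
    by (intro bexI[of _ "- x"]) (auto simp: rat_group_def)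
qed (auto simp: rat_group_def)

lemma Ints_normal_rat_group: "\<int> \<lhd> rat_group"
proof -
  interpret R: comm_group rat_group by (rule rat_group_comm_group)
  have inv: "inv\<^bsub>rat_group\<^esub> x = - x" for x
    by (rule R.inv_equality) (auto simp: rat_group_def)
  have "subgroup \<int> rat_group"
    by (rule R.subgroupI) (auto simp: inv, auto simp: rat_group_def)
  then show ?thesis using R.normal_iff_subgroup by blast
qed

lemma Ints_coset_eq_iff: "\<int> #>\<^bsub>rat_group\<^esub> x = \<int> #>\<^bsub>rat_group\<^esub> y \<longleftrightarrow> x - y \<in> \<int>"
proof
  assume "\<int> #>\<^bsub>rat_group\<^esub> x = \<int> #>\<^bsub>rat_group\<^esub> y"
  moreover have "x \<in> \<int> #>\<^bsub>rat_group\<^esub> x" unfolding r_coset_def by (force simp: rat_group_def)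
  ultimately have "x \<in> \<int> #>\<^bsub>rat_group\<^esub> y" by simp
  then obtain z where "z \<in> \<int>" "x = z + y" unfolding r_coset_def by (auto simp: rat_group_def)
  then show "x - y \<in> \<int>" by simp
next
  assume xy: "x - y \<in> \<int>"
  have *: "\<int> #>\<^bsub>rat_group\<^esub> u \<subseteq> \<int> #>\<^bsub>rat_group\<^esub> v" if uv: "u - v \<in> \<int>" for u v
  proof
    fix w assume "w \<in> \<int> #>\<^bsub>rat_group\<^esub> u"
    then obtain z where "z \<in> \<int>" "w = z + u" unfolding r_coset_def by (auto simp: rat_group_def)
    then have "w = (z + (u - v)) + v" "z + (u - v) \<in> \<int>" using uv by auto
    then show "w \<in> \<int> #>\<^bsub>rat_group\<^esub> v" unfolding r_coset_def by (force simp: rat_group_def)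
  qed
  have "y - x \<in> \<int>" using xy Ints_minus by fastforce
  then show "\<int> #>\<^bsub>rat_group\<^esub> x = \<int> #>\<^bsub>rat_group\<^esub> y" using xy * by (intro equalityI)
qed

lemma of_int_divide_in_Ints_iff:
  fixes a b :: int
  assumes "b \<noteq> 0"
  shows "(of_int a / of_int b :: rat) \<in> \<int> \<longleftrightarrow> b dvd a"
proof
  assume "(of_int a / of_int b :: rat) \<in> \<int>"
  then obtain z where "(of_int a / of_int b :: rat) = of_int z" unfolding Ints_def by auto
  then have "(of_int a :: rat) = of_int (z * b)" using assms by (simp add: field_simps)
  then show "b dvd a" by (simp only: of_int_eq_iff) simp
qed (use assms in auto)

lemma (in group) root_tower_pow:
  assumes "\<And>n. c n \<in> carrier G" "\<And>n. c (Suc n) [^] (p::nat) = c n"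
  shows "c (n + m) [^] (p ^ m) = c n"
proof (induction m)
  case (Suc m)
  have "c (n + Suc m) [^] (p ^ Suc m) = (c (Suc (n + m)) [^] p) [^] (p ^ m)"
    using assms(1) by (simp add: nat_pow_pow)
  then show ?case using assms(2) Suc by simp
qed (use assms(1) in simp)

text \<open>Here \<open>c n\<close> plays the part of the coset of \<open>1 / p ^ n\<close>. Both
  sides become powers of \<open>c (n + m)\<close>, whose order \<open>p ^ (n + m)\<close> turns
  equality into divisibility.\<close>

lemma (in group) pruefer_tower_eq_iff:
  fixes a b :: int
  assumes "p > 0" and c: "\<And>n. c n \<in> carrier G" and ord: "\<And>n. ord (c n) = p ^ n"
    and root: "\<And>n. c (Suc n) [^] p = c n"
  shows "c n [^] a = c m [^] b \<longleftrightarrow>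
    (of_int a / of_nat p ^ n - of_int b / of_nat p ^ m :: rat) \<in> \<int>"
proof -
  have roots: "c (n + m) [^] (p ^ m) = c n" for n m
    using root_tower_pow[of c p n m] c root by simp
  have "c n [^] a = c (n + m) [^] (int (p ^ m) * a)"
    using roots[of n m] c by (metis int_pow_int int_pow_pow)
  moreover have "c m [^] b = c (n + m) [^] (int (p ^ n) * b)"
    using roots[of m n] c by (metis int_pow_int int_pow_pow add.commute)
  ultimately have "c n [^] a = c m [^] b \<longleftrightarrow> int (p ^ (n + m)) dvd int (p ^ n) * b - int (p ^ m) * a"
    using c by (simp add: int_pow_eq ord)
  also have "\<dots> \<longleftrightarrow> int (p ^ (n + m)) dvd int (p ^ m) * a - int (p ^ n) * b"
    by (rule dvd_diff_commute)
  also have "\<dots> \<longleftrightarrow> (of_int (int (p ^ m) * a - int (p ^ n) * b) / of_int (int (p ^ (n + m))) :: rat) \<in> \<int>"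
    using assms(1) by (intro of_int_divide_in_Ints_iff[symmetric]) simp
  also have "(of_int (int (p ^ m) * a - int (p ^ n) * b) / of_int (int (p ^ (n + m))) :: rat)
      = of_int a / of_nat p ^ n - of_int b / of_nat p ^ m"
    using assms(1) by (simp add: field_simps power_add)
  finally show ?thesis .
qed

lemma (in comm_group) pruefer_tower_iso:
  assumes "p > 0" and c: "\<And>n. c n \<in> carrier G" and ord: "\<And>n. ord (c n) = p ^ n"
    and root: "\<And>n. c (Suc n) [^] p = c n"
    and gen: "\<And>h. h \<in> carrier G \<Longrightarrow> \<exists>n (a::int). h = c n [^] a"
  shows "G \<cong> pruefer_group p"
proof -
  interpret N: normal \<int> rat_group by (rule Ints_normal_rat_group)
  let ?Q = "rat_group Mod \<int>"
  \<comment> \<open>One representation is chosen for each element; by \<open>eq_iff\<close> any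
    other changes the fraction only by an integer.\<close>
  obtain n a where na: "\<And>h. h \<in> carrier G \<Longrightarrow> h = c (n h) [^] (a h :: int)" using gen by metis
  define \<psi> where "\<psi> h = \<int> #>\<^bsub>rat_group\<^esub> (of_int (a h) / of_nat p ^ n h)" for h
  note eq_iff = pruefer_tower_eq_iff[OF assms(1) c ord root]
  have \<psi>: "\<psi> (c m [^] b) = \<int> #>\<^bsub>rat_group\<^esub> (of_int b / of_nat p ^ m)" for m and b :: int
  proof -
    have "c (n (c m [^] b)) [^] a (c m [^] b) = c m [^] b" using na c int_pow_closed by metis
    then show ?thesis unfolding \<psi>_def Ints_coset_eq_iff by (simp only: eq_iff)
  qed
  have hom: "\<psi> \<in> hom G ?Q"
  proof (rule homI)
    show "\<psi> h \<in> carrier ?Q" for h unfolding \<psi>_def carrier_FactGroup by (auto simp: rat_group_def)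
  next
    fix g h assume gh: "g \<in> carrier G" "h \<in> carrier G"
    \<comment> \<open>\<open>p ^ m\<close> is a common denominator; \<open>d\<close> and
      \<open>e\<close> are the numerators over it.\<close>
    define m where "m = n g + n h"
    define d where "d = a g * int (p ^ n h)"
    define e where "e = a h * int (p ^ n g)"
    have d: "of_int d / of_nat p ^ m = (of_int (a g) / of_nat p ^ n g :: rat)"
      and e: "of_int e / of_nat p ^ m = (of_int (a h) / of_nat p ^ n h :: rat)"
      using assms(1) unfolding d_def e_def m_def by (simp_all add: power_add)
    have "g = c m [^] d" "h = c m [^] e"
      using na[OF gh(1)] na[OF gh(2)] eq_iff[of "n g" "a g" m d] eq_iff[of "n h" "a h" m e] d e
      by auto
    then have "g \<otimes> h = c m [^] (d + e)" using c by (simp add: int_pow_mult)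
    then have "\<psi> (g \<otimes> h) = \<int> #>\<^bsub>rat_group\<^esub> (of_int d / of_nat p ^ m + of_int e / of_nat p ^ m)"
      by (simp add: \<psi> add_divide_distrib)
    also have "\<dots> = \<psi> g \<otimes>\<^bsub>?Q\<^esub> \<psi> h"
      unfolding \<psi>_def mult_FactGroup d e
      using N.rcos_sum[of "of_int (a g) / of_nat p ^ n g" "of_int (a h) / of_nat p ^ n h"]
      by (simp add: rat_group_def)
    finally show "\<psi> (g \<otimes> h) = \<psi> g \<otimes>\<^bsub>?Q\<^esub> \<psi> h" .
  qed
  interpret \<psi>: group_hom G ?Q \<psi>
    using N.factorgroup_is_group hom by (simp add: group_hom_def group_hom_axioms_def is_group)
  have inj: "inj_on \<psi> (carrier G)"
  proof (rule inj_onI)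
    fix g h assume gh: "g \<in> carrier G" "h \<in> carrier G" "\<psi> g = \<psi> h"
    then show "g = h"
      using na[OF gh(1)] na[OF gh(2)] eq_iff[of "n g" "a g" "n h" "a h"]
      unfolding \<psi>_def Ints_coset_eq_iff by simp
  qed
  let ?S = "range (\<lambda>i::nat. \<int> #>\<^bsub>rat_group\<^esub> (1 / of_nat p ^ i))"
  have \<psi>c: "\<psi> (c i) = \<int> #>\<^bsub>rat_group\<^esub> (1 / of_nat p ^ i)" for i
    using \<psi>[of i 1] c by simp
  have S: "?S \<subseteq> carrier ?Q" unfolding carrier_FactGroup by (auto simp: rat_group_def)
  have "generate ?Q ?S \<subseteq> \<psi> ` carrier G"
    using c by (intro \<psi>.H.generate_subgroup_incl \<psi>.img_is_subgroup) (auto simp flip: \<psi>c)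
  moreover have "\<psi> ` carrier G \<subseteq> generate ?Q ?S"
  proof
    fix y assume "y \<in> \<psi> ` carrier G"
    then obtain m and b :: int where y: "y = \<psi> (c m [^] b)" using gen by blast
    have "\<psi> (c m) \<in> generate ?Q ?S" unfolding \<psi>c by (intro generate.incl) auto
    then have "\<psi> (c m) [^]\<^bsub>?Q\<^esub> b \<in> generate ?Q ?S"
      using \<psi>.H.subgroup_int_pow_closed[OF \<psi>.H.generate_is_subgroup[OF S]] by blast
    then show "y \<in> generate ?Q ?S" using y \<psi>.hom_int_pow[of "c m" b] c by simp
  qed
  ultimately have "\<psi> ` carrier G = carrier (pruefer_group p)"
    unfolding pruefer_group_def carrier_subgroup_generated using S by (simp add: Int_absorb1)
  then have "\<psi> \<in> iso G (pruefer_group p)"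
    using hom inj by (auto simp: iso_def hom_def bij_betw_def pruefer_group_def)
  then show ?thesis by (rule is_isoI)
qed

section \<open>Cyclic or Pruefer\<close>

context orbit_chain_prime
begin

lemma power_linear:
  assumes "g \<in> carrier G" "h \<in> carrier G" "finite_order G g" "finite_order G h"
  shows "(\<exists>j::int. g = h [^] j) \<or> (\<exists>j::int. h = g [^] j)"
  using below_linear[OF assms(1,2)] below_imp_power[OF assms(1,2) _ assms(4)]
    below_imp_power[OF assms(2,1) _ assms(3)] by blast

text \<open>The order of \<open>h\<close> is a power of \<open>p\<close>, so \<open>i\<close> is
  invertible modulo it; \<open>u\<close> is a Bezout inverse.\<close>

lemma coprime_pow_invert:
  assumes "h \<in> carrier G" "finite_order G h" "\<not> int p dvd i"
  shows "\<exists>u::int. h = (h [^] i) [^] u"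
proof -
  obtain k where k: "ord h = p ^ k" using ord_prime_power[OF assms(1,2)] .
  have "coprime i (int p ^ k)"
    using prime_imp_coprime[of "int p" i] assms(3) prime_p by (simp add: coprime_commute)
  then obtain u v where "u * i + v * int p ^ k = 1"
    using bezout_int[of i "int p ^ k"] by auto
  then have "i * u - 1 = int (ord h) * (- v)" unfolding k by (simp add: algebra_simps)
  then have "int (ord h) dvd i * u - 1" by (rule dvdI)
  then have "h [^] (1::int) = h [^] (i * u)" by (rule iffD2[OF int_pow_eq[OF assms(1)]])
  then have "h = (h [^] i) [^] u" using assms(1) by (metis int_pow_1 int_pow_pow)
  then show ?thesis by blast
qed

lemma periodic_cyclic_case:
  assumes "periodic G" "g \<in> carrier G" "\<And>h. h \<in> carrier G \<Longrightarrow> \<exists>j::int. h = g [^] j"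
  shows "cyclic_group G \<and> finite (carrier G) \<and> (\<exists>k. card (carrier G) = p ^ k)"
proof -
  have carr: "carrier G = range (\<lambda>j::int. g [^] j)" using assms by blast
  have "finite_order G g" using assms unfolding periodic_def by blast
  then obtain k where k: "ord g = p ^ k" using ord_prime_power assms by blast
  have gen: "generate G {g} = carrier G" using generate_pow[OF assms(2)] carr by auto
  have card: "card (carrier G) = p ^ k" using generate_pow_card[OF assms(2)] gen k by simp
  moreover have "finite (carrier G)" using card p_gt_1 by (intro card_ge_0_finite) simp
  moreover have "cyclic_group G" using cyclic_group carr assms(2) by blast
  ultimately show ?thesis by blast
qed

text \<open>Without a generator of the whole group, every element has a \<open>p\<close>-th root.
  Extracting roots repeatedly gives a tower, which exhausts \<open>G\<close> because of any two
  elements one is a power of the other.\<close>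

lemma periodic_pruefer_case:
  assumes per: "periodic G"
    and noncyclic: "\<And>g. g \<in> carrier G \<Longrightarrow> \<exists>h\<in>carrier G. \<forall>j::int. h \<noteq> g [^] j"
  shows "G \<cong> pruefer_group p"
proof -
  have fo: "finite_order G g" if "g \<in> carrier G" for g
    using per that unfolding periodic_def by blast
  have ex_root: "\<exists>h\<in>carrier G. h [^] p = g" if g: "g \<in> carrier G" for g
  proof -
    obtain h where h: "h \<in> carrier G" "\<forall>j::int. h \<noteq> g [^] j" using noncyclic g by blast
    then obtain i :: int where i: "g = h [^] i" using power_linear[OF g h(1)] fo g h by blast
    \<comment> \<open>Otherwise \<open>h\<close> would be a power of \<open>g\<close>.\<close>
    have "int p dvd i" using coprime_pow_invert[of h i] h fo i by blast
    then obtain l where "i = l * int p" by (metis dvd_def mult.commute)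
    then have "g = (h [^] l) [^] p" using i h by (metis int_pow_int int_pow_pow)
    then show ?thesis using h by blast
  qed
  obtain c1 where c1: "c1 \<in> carrier G" "c1 \<noteq> \<one>" "c1 [^] p = \<one>"
  proof -
    \<comment> \<open>That \<open>\<one>\<close> does not generate supplies a nontrivial element;
      the last nontrivial term among its iterated \<open>p\<close>-th powers is the required
      \<open>c1\<close>.\<close>
    obtain h where h: "h \<in> carrier G" "\<forall>j::int. h \<noteq> \<one> [^] j" using noncyclic[of \<one>] by blast
    have "h \<noteq> \<one>" using h(2) int_pow_one by metis
    have ex: "\<exists>k. h [^] (p ^ k) = \<one>" using finite_order_pow_prime h fo by metis
    define k where "k = (LEAST k. h [^] (p ^ k) = \<one>)"
    have k: "h [^] (p ^ k) = \<one>" unfolding k_def using LeastI_ex[OF ex] .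
    then have "k \<noteq> 0" using \<open>h \<noteq> \<one>\<close> h by (intro notI) simp
    then obtain l where l: "k = Suc l" using not0_implies_Suc by blast
    have "h [^] (p ^ l) \<noteq> \<one>" using not_less_Least[of l "\<lambda>k. h [^] (p ^ k) = \<one>"] l k_def by auto
    moreover have "(h [^] (p ^ l)) [^] p = \<one>" using k l h by (simp add: nat_pow_pow mult.commute)
    ultimately show ?thesis using that h by blast
  qed
  have "\<exists>d. \<forall>n. (d n \<in> carrier G \<and> (n = 0 \<longrightarrow> d n = c1)) \<and> d (Suc n) [^] p = d n"
  proof (rule dependent_nat_choice)
    show "\<exists>h. (h \<in> carrier G \<and> (Suc n = 0 \<longrightarrow> h = c1)) \<and> h [^] p = g"
      if "g \<in> carrier G \<and> (n = 0 \<longrightarrow> g = c1)" for g n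
      using ex_root that by auto
  qed (use c1 in auto)
  then obtain d where d: "\<And>n. d n \<in> carrier G \<and> (n = 0 \<longrightarrow> d n = c1)"
      "\<And>n. d (Suc n) [^] p = d n"
    by blast
  \<comment> \<open>The shift puts \<open>\<one>\<close> at index 0, so that \<open>c n\<close> has
    order exactly \<open>p ^ n\<close>.\<close>
  define c where "c n = (case n of 0 \<Rightarrow> \<one> | Suc m \<Rightarrow> d m)" for n
  have c: "c n \<in> carrier G" for n using d unfolding c_def by (cases n) auto
  have c_Suc: "c (Suc 0) = c1" unfolding c_def using d(1)[of 0] by simp
  have root: "c (Suc n) [^] p = c n" for n
    using d c1 unfolding c_def by (cases n) auto
  have roots: "c (n + m) [^] (p ^ m) = c n" for n m
    using root_tower_pow[of c p n m] c root by simp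
  have ord: "ord (c n) = p ^ n" for n
  proof (cases n)
    case 0
    then show ?thesis unfolding c_def by simp
  next
    case (Suc m)
    have "c n [^] (p ^ n) = \<one>" using roots[of 0 n] by (simp add: c_def)
    then have "ord (c n) dvd p ^ n" using c by (simp add: pow_eq_id)
    then obtain i where i: "i \<le> n" "ord (c n) = p ^ i" using divides_primepow_nat[OF prime_p] by blast
    \<comment> \<open>The exponent \<open>p ^ m\<close> takes \<open>c n\<close> down to
      \<open>c1\<close> and not to \<open>\<one>\<close>, which excludes a smaller order.\<close>
    have "c n [^] (p ^ m) \<noteq> \<one>" using roots[of "Suc 0" m] c_Suc c1 Suc by simp
    then have "\<not> p ^ i dvd p ^ m" using c i by (simp add: pow_eq_id)
    then have "\<not> i \<le> m" using le_imp_power_dvd by blast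
    then show ?thesis using i Suc by (simp add: le_Suc_eq)
  qed
  have gen: "\<exists>n (a::int). h = c n [^] a" if h: "h \<in> carrier G" for h
  proof -
    obtain k where k: "h [^] (p ^ k) = \<one>" using finite_order_pow_prime h fo by metis
    \<comment> \<open>The order \<open>p ^ Suc k\<close> is too large for a power of
      \<open>h\<close>, so \<open>h\<close> has to be a power of \<open>c (Suc k)\<close>.\<close>
    have "c (Suc k) \<noteq> h [^] i" for i :: int
    proof
      assume "c (Suc k) = h [^] i"
      then have "c (Suc k) [^] (p ^ k) = (h [^] (p ^ k)) [^] i"
        using h by (metis int_pow_int int_pow_pow mult.commute)
      then have "p ^ Suc k dvd p ^ k" using k ord c by (metis int_pow_one pow_eq_id)
      then show False using p_gt_1 dvd_imp_le[of "p ^ Suc k" "p ^ k"] by simp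
    qed
    then show ?thesis using power_linear[OF h c[of "Suc k"]] fo h c by blast
  qed
  show ?thesis by (rule pruefer_tower_iso[OF _ c ord root gen]) (use p_gt_1 in auto)
qed

end

section \<open>The torsion-free case\<close>

context orbit_chain_prime
begin

text \<open>By \<open>pow_transfer\<close> the exponent from the longer cycle also serves on the
  shorter one, and two exponents on one cycle agree modulo its length, a multiple of
  \<open>p ^ k\<close>.\<close>

lemma exponents_agree:
  fixes i j :: int
  assumes "f \<in> carrier G" "g \<in> carrier G" "y \<in> E" "z \<in> E"
    and "\<phi> f y = \<phi> (g [^] i) y" "\<phi> f z = \<phi> (g [^] j) z"
    and "p ^ k dvd period g y" "p ^ k dvd period g z"
  shows "int (p ^ k) dvd i - j"
proof -
  have *: "int (p ^ k) dvd i - j"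
    if "y \<in> E" "z \<in> E" "\<phi> f y = \<phi> (g [^] i) y" "\<phi> f z = \<phi> (g [^] j) z"
      "p ^ k dvd period g y" "period g y \<le> period g z" for y z and i j :: int
  proof -
    have "\<phi> (g [^] i) y = \<phi> (g [^] j) y"
      using pow_transfer[of g f y z i j] period_dvd_linear[of g y z] assms(1,2) that by simp
    then have "int (period g y) dvd i - j" using period_eq_iff assms(2) that(1) by blast
    then show ?thesis using that(5) by (meson dvd_trans int_dvd_int_iff)
  qed
  show ?thesis
  proof (cases "period g y \<le> period g z")
    case True
    then show ?thesis using *[of y z i j] assms by blast
  next
    case False
    then have "int (p ^ k) dvd j - i" using *[of z y j i] assms by simp
    then show ?thesis by (simp add: dvd_diff_commute)
  qed
qed

text \<open>Fix \<open>g \<noteq> \<one>\<close>. An element \<open>h\<close> with \<open>below h g\<close> acts on every cycle of \<open>g\<close> as a power of \<open>g\<close>; on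
  longer and longer cycles the exponents form a \<open>p\<close>-adic Cauchy sequence, whose limit is morally
  the exponent \<open>z\<close> in \<open>h = g\<^sup>z\<close>. A general \<open>h\<close> is first raised to a power \<open>p\<^sup>n\<close>, and the exponents
  are then divided by \<open>p\<^sup>n\<close>.\<close>

lemma torsion_free_exponents:
  assumes tf: "torsion_free G" and g: "g \<in> carrier G" "g \<noteq> \<one>"
  obtains s where "\<And>h. h \<in> carrier G \<Longrightarrow> padic_Cauchy p (s h)"
    and "\<And>h h'. \<lbrakk>h \<in> carrier G; h' \<in> carrier G\<rbrakk> \<Longrightarrow>
          (\<lambda>n. s (h \<otimes> h') n - (s h n + s h' n)) \<in> padic_null p"
    and "\<And>h. \<lbrakk>h \<in> carrier G; s h \<in> padic_null p\<rbrakk> \<Longrightarrow> h = \<one>"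
proof -
  note prime = prime_p
  have not_fo: "\<not> finite_order G g" using tf g unfolding torsion_free_def by blast
  \<comment> \<open>Were there no such cycle, all lengths would be smaller powers of
    \<open>p\<close>, and \<open>p ^ k\<close> would be an exponent of \<open>g\<close>.\<close>
  have "\<exists>y\<in>E. p ^ k dvd period g y" for k
  proof (rule ccontr)
    assume no: "\<not> (\<exists>y\<in>E. p ^ k dvd period g y)"
    have "period g x dvd p ^ k" if x: "x \<in> E" for x
    proof -
      obtain l where l: "period g x = p ^ l" using period_power g x by blast
      then have "\<not> k \<le> l" using no x le_imp_power_dvd by metis
      then show ?thesis using l by (simp add: le_imp_power_dvd)
    qed
    then have "g [^] (p ^ k) = \<one>" using g by (simp add: pow_eq_one_iff)
    moreover have "p ^ k > 0" using p_gt_1 by simp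
    ultimately show False using not_fo unfolding finite_order_def by blast
  qed
  then obtain y where y: "\<And>k. y k \<in> E" "\<And>k. p ^ k dvd period g (y k)" by metis
  have "\<exists>n. below (h [^] (p ^ n)) g" if "h \<in> carrier G" for h
    using below_some_power[OF g that] by blast
  then obtain N where N: "\<And>h. h \<in> carrier G \<Longrightarrow> below (h [^] (p ^ N h)) g" by metis
  \<comment> \<open>The value is determined only modulo \<open>period g (y k)\<close>, a multiple of
    \<open>p ^ k\<close>; other choices change \<open>s h\<close> by a null sequence.\<close>
  define j where "j h k = (SOME i::int. \<phi> (h [^] (p ^ N h)) (y k) = \<phi> (g [^] i) (y k))" for h k
  have j: "\<phi> (h [^] (p ^ N h)) (y k) = \<phi> (g [^] j h k) (y k)" if h: "h \<in> carrier G" for h k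
  proof -
    have "\<exists>i::int. \<phi> (h [^] (p ^ N h)) (y k) = \<phi> (g [^] i) (y k)"
      using N[OF h] y(1)[of k] unfolding below_def by blast
    then show ?thesis unfolding j_def by (rule someI_ex)
  qed
  define s where "s h k = (of_int (j h k) / of_nat (p ^ N h) :: rat)" for h k
  \<comment> \<open>Division by \<open>p ^ N h\<close> costs \<open>N h\<close> in valuation, hence
    the shifted bound.\<close>
  have agree: "padic_ge p (int k - int (N h)) (s h m - s h n)"
    if h: "h \<in> carrier G" "m \<ge> k" "n \<ge> k" for h k m n
  proof -
    have "int (p ^ k) dvd j h m - j h n"
    proof (rule exponents_agree[OF _ g(1) y(1)[of m] y(1)[of n] j[OF h(1)] j[OF h(1)]])
      show "p ^ k dvd period g (y m)" by (rule dvd_trans[OF le_imp_power_dvd[OF h(2)] y(2)])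
      show "p ^ k dvd period g (y n)" by (rule dvd_trans[OF le_imp_power_dvd[OF h(3)] y(2)])
    qed (use h in auto)
    then have "padic_ge p (int k) (of_int (j h m - j h n))" using padic_ge_int_iff prime by blast
    then have "padic_ge p (int k - int (N h)) (of_int (j h m - j h n) / of_nat (p ^ N h))"
      by (rule padic_ge_shift[OF prime])
    then show ?thesis unfolding s_def by (simp add: diff_divide_distrib)
  qed
  show ?thesis
  proof (rule that)
    fix h assume h: "h \<in> carrier G"
    show "padic_Cauchy p (s h)" unfolding padic_Cauchy_iff[OF prime]
    proof
      fix k
      have "padic_ge p (int k) (s h m - s h n)" if "m \<ge> k + N h" "n \<ge> k + N h" for m n
        using agree[OF h that] by simp
      then show "\<exists>M. \<forall>m\<ge>M. \<forall>n\<ge>M. padic_ge p (int k) (s h m - s h n)" by blast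
    qed
  next
    fix h h' assume h: "h \<in> carrier G" "h' \<in> carrier G"
    define a where "a = N h"
    define b where "b = N h'"
    define c where "c = N (h \<otimes> h')"
    \<comment> \<open>The exponents of \<open>h\<close>, \<open>h'\<close> and
      \<open>h \<otimes> h'\<close> belong to the powers \<open>p ^ a\<close>, \<open>p ^ b\<close>
      and \<open>p ^ c\<close>. Raising to the common power \<open>p ^ (a + b + c)\<close> makes
      them comparable at \<open>y k\<close>; dividing by it again lowers the bound by
      \<open>a + b + c\<close>.\<close>
    have exps: "padic_ge p (int k - int (a + b + c)) (s (h \<otimes> h') k - (s h k + s h' k))" for k
    proof -
      have pw: "\<phi> (f [^] (p ^ (N f + n))) (y k) = \<phi> (g [^] (j f k * int (p ^ n))) (y k)"
        if "f \<in> carrier G" for f n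
        using act_pow_eq_pow[OF _ g(1) y(1)[of k] j[OF that], of "p ^ n"] that
        by (simp add: nat_pow_pow power_add)
      let ?M = "p ^ (a + b + c)"
      have "\<phi> (g [^] (j (h \<otimes> h') k * int (p ^ (a + b)))) (y k) = \<phi> ((h \<otimes> h') [^] ?M) (y k)"
        using pw[of "h \<otimes> h'" "a + b"] h unfolding c_def by (simp add: ac_simps)
      also have "\<dots> = \<phi> (h [^] ?M) (\<phi> (h' [^] ?M) (y k))"
        using h y(1) by (simp add: nat_pow_distrib composition_rule)
      also have "\<dots> = \<phi> (h [^] ?M) (\<phi> (g [^] (j h' k * int (p ^ (a + c)))) (y k))"
        using pw[of h' "a + c"] h unfolding b_def by (simp add: ac_simps)
      also have "\<dots> = \<phi> (g [^] (j h' k * int (p ^ (a + c)))) (\<phi> (h [^] ?M) (y k))"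
        using h g y(1) by (intro act_commute) auto
      also have "\<dots> = \<phi> (g [^] (j h' k * int (p ^ (a + c)))) (\<phi> (g [^] (j h k * int (p ^ (b + c)))) (y k))"
        using pw[of h "b + c"] h unfolding a_def by (simp add: ac_simps)
      also have "\<dots> = \<phi> (g [^] (j h' k * int (p ^ (a + c)) + j h k * int (p ^ (b + c)))) (y k)"
        using g y(1) by (simp only: act_pow_add)
      finally have "int (period g (y k)) dvd j (h \<otimes> h') k * int (p ^ (a + b))
          - (j h' k * int (p ^ (a + c)) + j h k * int (p ^ (b + c)))"
        using period_eq_iff g y(1) by blast
      then have "int (p ^ k) dvd j (h \<otimes> h') k * int (p ^ (a + b))
          - (j h' k * int (p ^ (a + c)) + j h k * int (p ^ (b + c)))"
        using y(2)[of k] by (meson dvd_trans int_dvd_int_iff)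
      then have "padic_ge p (int k) (of_int (j (h \<otimes> h') k * int (p ^ (a + b))
          - (j h' k * int (p ^ (a + c)) + j h k * int (p ^ (b + c)))))"
        using padic_ge_int_iff prime by blast
      then have "padic_ge p (int k - int (a + b + c)) (of_int (j (h \<otimes> h') k * int (p ^ (a + b))
          - (j h' k * int (p ^ (a + c)) + j h k * int (p ^ (b + c)))) / of_nat ?M)"
        by (rule padic_ge_shift[OF prime])
      moreover have "of_int (j (h \<otimes> h') k * int (p ^ (a + b))
          - (j h' k * int (p ^ (a + c)) + j h k * int (p ^ (b + c)))) / of_nat ?M
          = s (h \<otimes> h') k - (s h k + s h' k)"
        using p_gt_1 unfolding s_def a_def[symmetric] b_def[symmetric] c_def[symmetric]
        by (simp add: power_add field_simps)
      ultimately show ?thesis by simp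
    qed
    show "(\<lambda>n. s (h \<otimes> h') n - (s h n + s h' n)) \<in> padic_null p"
      unfolding padic_null_iff[OF prime]
    proof
      fix k
      have "padic_ge p (int k) (s (h \<otimes> h') n - (s h n + s h' n))" if "n \<ge> k + (a + b + c)" for n
        using padic_ge_mono[OF prime exps[of n], of "int k"] that by simp
      then show "\<exists>M. \<forall>n\<ge>M. padic_ge p (int k) (s (h \<otimes> h') n - (s h n + s h' n))" by blast
    qed
  next
    fix h assume h: "h \<in> carrier G" and null: "s h \<in> padic_null p"
    \<comment> \<open>A null sequence provides, for each \<open>x\<close>, an exponent divisible by
      \<open>period g x\<close>.\<close>
    have "\<phi> (h [^] (p ^ N h)) x = x" if x: "x \<in> E" for x
    proof -
      obtain e where e: "period g x = p ^ e" using period_power g x by blast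
      obtain M where M: "\<forall>n\<ge>M. padic_ge p (int e) (s h n)"
        using null unfolding padic_null_iff[OF prime] by blast
      \<comment> \<open>\<open>k \<ge> M\<close> makes \<open>j h k\<close> divisible by
        \<open>p ^ e\<close>; \<open>k \<ge> e\<close> makes the cycle of \<open>y k\<close> long
        enough for its exponent to transfer to \<open>x\<close>.\<close>
      define k where "k = max M e"
      have "padic_ge p (int e) (of_int (int (p ^ N h)) * s h k)"
        using M by (intro padic_ge_mult_int[OF prime]) (auto simp: k_def)
      then have "padic_ge p (int e) (of_int (j h k))" using p_gt_1 by (simp add: s_def)
      then have dvd: "int (p ^ e) dvd j h k" using padic_ge_int_iff prime by blast
      obtain i :: int where i: "\<phi> (h [^] (p ^ N h)) x = \<phi> (g [^] i) x"
        using N[OF h] x unfolding below_def by blast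
      have "p ^ e dvd p ^ k" unfolding k_def by (simp add: le_imp_power_dvd)
      then have "period g x dvd period g (y k)" using y(2)[of k] e dvd_trans by metis
      then have "\<phi> (h [^] (p ^ N h)) x = \<phi> (g [^] j h k) x"
        using pow_transfer[OF g(1) _ x y(1) i _ j[OF h]] h by simp
      then show ?thesis using period_iff[OF g(1) x] dvd e by simp
    qed
    then have "h [^] (p ^ N h) = \<one>" using h by (intro eq_if_act_eq) auto
    moreover have "p ^ N h > 0" using p_gt_1 by simp
    ultimately have "finite_order G h" unfolding finite_order_def by blast
    then show "h = \<one>" using tf h unfolding torsion_free_def by blast
  qed
qed

lemma torsion_free_embeds:
  assumes "torsion_free G"
  shows "\<exists>H. subgroup H (add_monoid (padic_field p)) \<and>
           G \<cong> (add_monoid (padic_field p))\<lparr>carrier := H\<rparr>"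
proof (cases "carrier G = {\<one>}")
  case True
  \<comment> \<open>The trivial group has no \<open>g \<noteq> \<one>\<close> to measure exponents
    against; the zero sequence embeds it.\<close>
  show ?thesis
    by (rule embeds_in_padic_field[OF prime_p is_group, of "\<lambda>_ _. 0"])
       (use True padic_ge_zero[OF prime_p] padic_Cauchy_zero[OF prime_p] in
         \<open>auto simp: padic_null_iff[OF prime_p]\<close>)
next
  case False
  then obtain g where "g \<in> carrier G" "g \<noteq> \<one>" by blast
  then obtain s where "\<And>h. h \<in> carrier G \<Longrightarrow> padic_Cauchy p (s h)"
    and "\<And>h h'. \<lbrakk>h \<in> carrier G; h' \<in> carrier G\<rbrakk> \<Longrightarrow>
          (\<lambda>n. s (h \<otimes> h') n - (s h n + s h' n)) \<in> padic_null p"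
    and "\<And>h. \<lbrakk>h \<in> carrier G; s h \<in> padic_null p\<rbrakk> \<Longrightarrow> h = \<one>"
    using torsion_free_exponents[OF assms] by blast
  then show ?thesis using embeds_in_padic_field[OF prime_p is_group] by blast
qed

end

section \<open>Permutation groups\<close>

lemma perm_group_action:
  assumes "subgroup G (BijGroup \<Omega>)"
  shows "faithful_action (perm_group \<Omega> G) \<Omega> (\<lambda>h. h)"
proof -
  have "group (perm_group \<Omega> G)"
    using subgroup.subgroup_is_group[OF assms group_BijGroup] unfolding perm_group_def .
  moreover have "(\<lambda>h. h) \<in> hom (perm_group \<Omega> G) (BijGroup \<Omega>)"
    using subgroup.subset[OF assms] unfolding hom_def perm_group_def by auto
  ultimately show ?thesis
    by (simp add: faithful_action_def group_action_def faithful_action_axioms_def group_hom_def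
        group_hom_axioms_def group_BijGroup)
qed

text \<open>The cyclic group of \<open>g\<close> is generated inside the full symmetric group,
  whereas the locale computes in \<open>perm_group \<Omega> G\<close>; integer powers agree in the
  two.\<close>

lemma orbit_partition_eq:
  assumes "subgroup G (BijGroup \<Omega>)" "g \<in> G"
  shows "orbit_partition \<Omega> g = {range (\<lambda>i::int. (g [^]\<^bsub>perm_group \<Omega> G\<^esub> i) x) | x. x \<in> \<Omega>}"
proof -
  interpret B: group "BijGroup \<Omega>" by (rule group_BijGroup)
  have "g \<in> carrier (BijGroup \<Omega>)" using subgroup.subset[OF assms(1)] assms(2) by blast
  then have "carrier (subgroup_generated (BijGroup \<Omega>) {g}) =
      range (\<lambda>i::int. g [^]\<^bsub>perm_group \<Omega> G\<^esub> i)"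
    using B.int_pow_consistent[OF assms] B.carrier_subgroup_generated_by_singleton
    unfolding perm_group_def by simp
  then show ?thesis unfolding orbit_partition_def orbits_def orbit_def by auto
qed

lemma refines_imp_pow:
  assumes "subgroup G (BijGroup \<Omega>)" "g \<in> G" "h \<in> G" "x \<in> \<Omega>"
    and "refines \<Omega> (orbit_partition \<Omega> g) (orbit_partition \<Omega> h)"
  shows "\<exists>i::int. g x = (h [^]\<^bsub>perm_group \<Omega> G\<^esub> i) x"
proof -
  let ?P = "perm_group \<Omega> G"
  interpret faithful_action ?P \<Omega> "\<lambda>h. h" by (rule perm_group_action[OF assms(1)])
  interpret P: group ?P using group_hom by (rule group_hom.axioms(1))
  have carr: "g \<in> carrier ?P" "h \<in> carrier ?P" using assms by (auto simp: perm_group_def)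
  let ?X = "range (\<lambda>i::int. (g [^]\<^bsub>?P\<^esub> i) x)"
  have "?X \<in> orbit_partition \<Omega> g" using assms by (auto simp: orbit_partition_eq[OF assms(1,2)])
  then obtain z where z: "z \<in> \<Omega>" "?X \<subseteq> range (\<lambda>i::int. (h [^]\<^bsub>?P\<^esub> i) z)"
    using assms(5) unfolding refines_def orbit_partition_eq[OF assms(1,3)] by blast
  have "(g [^]\<^bsub>?P\<^esub> (0::int)) x \<in> ?X" "(g [^]\<^bsub>?P\<^esub> (1::int)) x \<in> ?X" by blast+
  moreover have "\<one>\<^bsub>?P\<^esub> x = x" using id_eq_one assms(4) by (metis restrict_apply')
  ultimately have "x \<in> ?X" "g x \<in> ?X" using carr by simp_all
  \<comment> \<open>Refinement puts \<open>x\<close> and \<open>g x\<close> into one cycle of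
    \<open>h\<close>, described from another base point \<open>z\<close>; the exponent leading from
    \<open>x\<close> to \<open>g x\<close> is therefore \<open>b - a\<close>.\<close>
  then obtain a b :: int where a: "x = (h [^]\<^bsub>?P\<^esub> a) z" and b: "g x = (h [^]\<^bsub>?P\<^esub> b) z"
    using z(2) by blast
  have "(h [^]\<^bsub>?P\<^esub> (b - a)) x = (h [^]\<^bsub>?P\<^esub> (b - a) \<otimes>\<^bsub>?P\<^esub> h [^]\<^bsub>?P\<^esub> a) z"
    using composition_rule[OF z(1), of "h [^]\<^bsub>?P\<^esub> (b - a)" "h [^]\<^bsub>?P\<^esub> a"] carr a by simp
  also have "\<dots> = g x" using carr b by (simp flip: P.int_pow_mult)
  finally show ?thesis by metis
qed

lemma orbit_chain_perm_group:
  assumes "subgroup G (BijGroup \<Omega>)" "refinement_chain \<Omega> (orbit_partitions \<Omega> G)"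
  shows "orbit_chain (perm_group \<Omega> G) \<Omega> (\<lambda>h. h)"
proof -
  interpret faithful_action "perm_group \<Omega> G" \<Omega> "\<lambda>h. h" by (rule perm_group_action[OF assms(1)])
  show ?thesis
  proof
    fix g h assume "g \<in> carrier (perm_group \<Omega> G)" "h \<in> carrier (perm_group \<Omega> G)"
    then have gh: "g \<in> G" "h \<in> G" by (simp_all add: perm_group_def)
    then have "refines \<Omega> (orbit_partition \<Omega> g) (orbit_partition \<Omega> h) \<or>
        refines \<Omega> (orbit_partition \<Omega> h) (orbit_partition \<Omega> g)"
      using assms(2) unfolding refinement_chain_def orbit_partitions_def by blast
    then show "(\<forall>x\<in>\<Omega>. \<exists>i::int. g x = (h [^]\<^bsub>perm_group \<Omega> G\<^esub> i) x) \<or>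
        (\<forall>x\<in>\<Omega>. \<exists>i::int. h x = (g [^]\<^bsub>perm_group \<Omega> G\<^esub> i) x)"
      using refines_imp_pow[OF assms(1)] gh by blast
  qed
qed

section \<open>The permutation group induced on an orbit\<close>

lemma (in group_action) orbit_restrict_Bij:
  assumes "g \<in> carrier G" "x \<in> E"
  shows "restrict (\<phi> g) (orbit G \<phi> x) \<in> Bij (orbit G \<phi> x)"
proof -
  interpret group G using group_hom by (rule group_hom.axioms(1))
  let ?Y = "orbit G \<phi> x"
  have Y: "?Y \<subseteq> E" using assms element_image unfolding orbit_def by blast
  have step: "\<phi> h y \<in> ?Y" if hy: "h \<in> carrier G" "y \<in> ?Y" for h y
  proof -
    obtain k where "k \<in> carrier G" "y = \<phi> k x" using hy unfolding orbit_def by blast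
    then have "\<phi> h y = \<phi> (h \<otimes> k) x" "h \<otimes> k \<in> carrier G"
      using hy composition_rule[OF assms(2), of h k] by simp_all
    then show ?thesis unfolding orbit_def by blast
  qed
  have "y \<in> \<phi> g ` ?Y" if y: "y \<in> ?Y" for y
  proof
    show "\<phi> (inv g) y \<in> ?Y" using step y assms by simp
    have "y \<in> E" using Y y by blast
    then show "y = \<phi> g (\<phi> (inv g) y)" using orbit_sym_aux[of "inv g" y] assms by simp
  qed
  then have "\<phi> g ` ?Y = ?Y" using step assms by blast
  moreover have "inj_on (\<phi> g) ?Y" using inj_on_subset[OF inj_prop Y] assms by blast
  ultimately show ?thesis unfolding Bij_def bij_betw_def by simp
qed

lemma induced_pow:
  assumes "subgroup G (BijGroup \<Omega>)" "g \<in> G" "x \<in> \<Omega>"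
  defines "Y \<equiv> orbit (perm_group \<Omega> G) (\<lambda>h. h) x"
  shows "restrict g Y [^]\<^bsub>induced_perm_group G Y\<^esub> (n::nat)
    = restrict (g [^]\<^bsub>perm_group \<Omega> G\<^esub> n) Y"
proof -
  interpret faithful_action "perm_group \<Omega> G" \<Omega> "\<lambda>h. h" by (rule perm_group_action[OF assms(1)])
  interpret P: group "perm_group \<Omega> G" using group_hom by (rule group_hom.axioms(1))
  have g: "g \<in> carrier (perm_group \<Omega> G)" using assms(2) by (simp add: perm_group_def)
  have Y: "Y \<subseteq> \<Omega>" using assms(3) element_image unfolding Y_def orbit_def by blast
  have Bij: "restrict h Y \<in> Bij Y" if "h \<in> carrier (perm_group \<Omega> G)" for h
    using orbit_restrict_Bij[OF that assms(3)] unfolding Y_def .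
  have gY: "g y \<in> Y" if "y \<in> Y" for y
    using Bij[OF g] that bij_betw_apply[of "restrict g Y" Y Y y] unfolding Bij_def by simp
  have one: "\<one>\<^bsub>induced_perm_group G Y\<^esub> = (\<lambda>y\<in>Y. y)"
    by (simp add: induced_perm_group_def perm_group_def BijGroup_def)
  \<comment> \<open>Multiplication in \<open>BijGroup Y\<close> is specified only on
    \<open>Bij Y\<close>, so restrictions have to be known to lie there before products can be
    computed.\<close>
  have mult: "f \<otimes>\<^bsub>induced_perm_group G Y\<^esub> f' = compose Y f f'" if "f \<in> Bij Y" "f' \<in> Bij Y" for f f'
    using that by (simp add: induced_perm_group_def perm_group_def BijGroup_def)
  show ?thesis
  proof (induction n)
    case 0
    have "restrict \<one>\<^bsub>perm_group \<Omega> G\<^esub> Y = (\<lambda>y\<in>Y. y)"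
      unfolding id_eq_one[symmetric] using Y by (intro restrict_ext) auto
    then show ?case using one by simp
  next
    case (Suc n)
    have gn: "g [^]\<^bsub>perm_group \<Omega> G\<^esub> n \<in> carrier (perm_group \<Omega> G)" using g by simp
    have "restrict g Y [^]\<^bsub>induced_perm_group G Y\<^esub> Suc n
        = compose Y (restrict (g [^]\<^bsub>perm_group \<Omega> G\<^esub> n) Y) (restrict g Y)"
      unfolding nat_pow_Suc Suc by (rule mult[OF Bij[OF gn] Bij[OF g]])
    also have "\<dots> = restrict (g [^]\<^bsub>perm_group \<Omega> G\<^esub> Suc n) Y"
      unfolding compose_def
    proof (rule restrict_ext)
      fix y assume y: "y \<in> Y"
      then have "y \<in> \<Omega>" using Y by blast
      from composition_rule[OF this gn g]
      show "restrict (g [^]\<^bsub>perm_group \<Omega> G\<^esub> n) Y (restrict g Y y)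
          = (g [^]\<^bsub>perm_group \<Omega> G\<^esub> Suc n) y"
        using y gY by simp
    qed
    finally show ?case .
  qed
qed

text \<open>The trivial group is both periodic and torsion-free, and on a finite
  \<open>\<Omega>\<close> it has finitely many orbits; hence infinitude of the orbits is asserted
  for nontrivial \<open>G\<close>.\<close>

theorem theorem1:
  fixes \<Omega> :: "'a set" and G :: "('a \<Rightarrow> 'a) set"
  assumes "subgroup G (BijGroup \<Omega>)"
    and "refinement_chain \<Omega> (orbit_partitions \<Omega> G)"
  shows "\<exists>p::nat. Factorial_Ring.prime p
    \<and> (\<forall>g\<in>G. \<forall>C\<in>orbit_partition \<Omega> g. finite C \<and> (\<exists>k. card C = p ^ k))
    \<and> comm_group (perm_group \<Omega> G)
    \<and> (periodic (perm_group \<Omega> G) \<or> torsion_free (perm_group \<Omega> G))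
    \<and> (periodic (perm_group \<Omega> G) \<longrightarrow>
         (cyclic_group (perm_group \<Omega> G) \<and> finite G \<and> (\<exists>k. card G = p ^ k))
         \<or> perm_group \<Omega> G \<cong> pruefer_group p)
    \<and> (torsion_free (perm_group \<Omega> G) \<longrightarrow>
         (\<exists>H. subgroup H (add_monoid (padic_field p))
            \<and> perm_group \<Omega> G \<cong> (add_monoid (padic_field p))\<lparr>carrier := H\<rparr>)
         \<and> (G \<noteq> {\<one>\<^bsub>BijGroup \<Omega>\<^esub>} \<longrightarrow> infinite (group_orbits \<Omega> G))
         \<and> (\<forall>Y\<in>group_orbits \<Omega> G. periodic (induced_perm_group G Y)))"
proof -
  let ?P = "perm_group \<Omega> G"
  interpret orbit_chain ?P \<Omega> "\<lambda>h. h" by (rule orbit_chain_perm_group[OF assms])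
  have carr: "carrier ?P = G" and one: "\<one>\<^bsub>?P\<^esub> = \<one>\<^bsub>BijGroup \<Omega>\<^esub>"
    by (simp_all add: perm_group_def)
  obtain p where p: "Factorial_Ring.prime p"
    "\<And>g x. \<lbrakk>g \<in> carrier ?P; x \<in> \<Omega>\<rbrakk> \<Longrightarrow> \<exists>k. period g x = p ^ k"
    using ex_prime_periods by blast
  interpret orbit_chain_prime ?P \<Omega> "\<lambda>h. h" p by unfold_locales (use p in auto)
  have cycles: "finite C \<and> (\<exists>k. card C = p ^ k)" if gC: "g \<in> G" "C \<in> orbit_partition \<Omega> g" for g C
  proof -
    obtain x where x: "x \<in> \<Omega>" "C = range (\<lambda>i::int. (g [^]\<^bsub>?P\<^esub> i) x)"
      using gC orbit_partition_eq[OF assms(1) gC(1)] by blast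
    have "C = (\<lambda>i::nat. (g [^]\<^bsub>?P\<^esub> i) x) ` {..<period g x}"
      using finite_cycle(1)[of g x] x gC carr by simp
    moreover have "inj_on (\<lambda>i::nat. (g [^]\<^bsub>?P\<^esub> i) x) {..<period g x}"
      using finite_cycle(2)[of g x] x gC carr by simp
    ultimately have "finite C" "card C = period g x" by (simp_all add: card_image)
    then show ?thesis using period_power x gC carr by auto
  qed
  have periodic_case: "(cyclic_group ?P \<and> finite G \<and> (\<exists>k. card G = p ^ k)) \<or> ?P \<cong> pruefer_group p"
    if per: "periodic ?P"
  proof (cases "\<exists>g\<in>carrier ?P. \<forall>h\<in>carrier ?P. \<exists>j::int. h = g [^]\<^bsub>?P\<^esub> j")
    case True
    then show ?thesis using periodic_cyclic_case[OF per] carr by metis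
  next
    case False
    then show ?thesis using periodic_pruefer_case[OF per] by blast
  qed
  have infinite_orbits: "infinite (group_orbits \<Omega> G)"
    if tf: "torsion_free ?P" and nontriv: "G \<noteq> {\<one>\<^bsub>BijGroup \<Omega>\<^esub>}"
  proof -
    obtain g where "g \<in> carrier ?P" "g \<noteq> \<one>\<^bsub>?P\<^esub>"
      using nontriv subgroup.one_closed[OF assms(1)] carr one by auto
    then show ?thesis
      using tf finite_order_if_finite_orbits unfolding torsion_free_def group_orbits_def by blast
  qed
  have induced: "periodic (induced_perm_group G Y)" if Y: "Y \<in> group_orbits \<Omega> G" for Y
    unfolding periodic_def
  proof
    obtain x where x: "x \<in> \<Omega>" "Y = orbit ?P (\<lambda>h. h) x"
      using Y unfolding group_orbits_def orbits_def by blast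
    fix f assume "f \<in> carrier (induced_perm_group G Y)"
    then obtain g where g: "g \<in> G" "f = restrict g Y"
      by (auto simp: induced_perm_group_def perm_group_def)
    \<comment> \<open>One exponent serves the whole orbit: \<open>period g x\<close> is the cycle
      length of \<open>g\<close> at every point of \<open>Y\<close>.\<close>
    have "f [^]\<^bsub>induced_perm_group G Y\<^esub> period g x = restrict (g [^]\<^bsub>?P\<^esub> period g x) Y"
      using induced_pow[OF assms(1) g(1) x(1)] g x by simp
    also have "\<dots> = (\<lambda>y\<in>Y. y)"
      using pow_period_on_orbit[of g x] x g carr by (intro restrict_ext) auto
    also have "\<dots> = \<one>\<^bsub>induced_perm_group G Y\<^esub>"
      by (simp add: induced_perm_group_def perm_group_def BijGroup_def)
    finally show "finite_order (induced_perm_group G Y) f"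
      unfolding finite_order_def using period_pos[of g x] x g carr by blast
  qed
  note facts = p(1) cycles comm_group_axioms periodic_or_torsion_free periodic_case
    torsion_free_embeds infinite_orbits induced
  show ?thesis
    by (rule exI[of _ p], intro conjI ballI impI) (use facts in blast)+
qed

end
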